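(* There is an $n_0$ such that for all $n\ge n_0$ with $3\mid n$ there exists a $k$-regular optimal $3$-superimposed design on $n$ vertices for every integer $k$ with $1\le k\le \frac{1}{25}n^{2/3}$; in particular $$\frac{1}{25}n^{2/3}\le k'(3,n).$$
   Context: A family $\mathcal F$ of subsets of an $n$-element vertex set is $e$-cover-free if for any distinct members $A_0,A_1,\dots,A_e\in\mathcal F$ one has $A_0\not\subseteq\bigcup_{i=1}^e A_i$; it is $e$-union-free if for any two distinct subfamilies $\mathcal A,\mathcal B\subseteq\mathcal F$ with $0<|\mathcal A|,|\mathcal B|\le e$ one has $\bigcup_{A\in\mathcal A}A\ne\bigcup_{B\in\mathcal B}B$. A hypergraph is linear if any two distinct edges share at most one vertex, and $k$-regular if every vertex lies in exactly $k$ edges. An $n$-vertex $k$-regular optimal $3$-superimposed design is a $3$-uniform, $k$-regular, linear hypergraph on $n$ vertices that is $2$-cover-free and $3$-union-free. $k'(3,n)$ denotes the maximum $k$ for which such a design exists. *)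

theory Defs
  imports Complex_Main
begin

definition cover_free :: "nat \<Rightarrow> 'a set set \<Rightarrow> bool" where
  "cover_free e F \<longleftrightarrow>
     (\<forall>A :: nat \<Rightarrow> 'a set. inj_on A {0..e} \<and> A ` {0..e} \<subseteq> F \<longrightarrow>
        \<not> A 0 \<subseteq> (\<Union>i\<in>{1..e}. A i))"

text \<open>A positive cardinality implies finiteness of the subfamily.\<close>

definition union_free :: "nat \<Rightarrow> 'a set set \<Rightarrow> bool" where
  "union_free e F \<longleftrightarrow>
     (\<forall>\<A> \<B>. \<A> \<subseteq> F \<and> \<B> \<subseteq> F \<and> \<A> \<noteq> \<B> \<and>
        0 < card \<A> \<and> card \<A> \<le> e \<and> 0 < card \<B> \<and> card \<B> \<le> e \<longrightarrow>
        \<Union>\<A> \<noteq> \<Union>\<B>)"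

definition uniform :: "nat \<Rightarrow> 'a set set \<Rightarrow> bool" where
  "uniform r F \<longleftrightarrow> (\<forall>A\<in>F. finite A \<and> card A = r)"

text \<open>
  The intersection is required to be finite explicitly, because \<^const>\<open>card\<close> is zero on
  infinite sets.
\<close>

definition linear_family :: "'a set set \<Rightarrow> bool" where
  "linear_family F \<longleftrightarrow>
     (\<forall>A\<in>F. \<forall>B\<in>F. A \<noteq> B \<longrightarrow> finite (A \<inter> B) \<and> card (A \<inter> B) \<le> 1)"

definition regular_on :: "'a set \<Rightarrow> nat \<Rightarrow> 'a set set \<Rightarrow> bool" where
  "regular_on V k F \<longleftrightarrow> (\<forall>v\<in>V. finite {A \<in> F. v \<in> A} \<and> card {A \<in> F. v \<in> A} = k)"

definition optimal_superimposed_design3 :: "'a set \<Rightarrow> nat \<Rightarrow> 'a set set \<Rightarrow> bool" where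
  "optimal_superimposed_design3 V k F \<longleftrightarrow>
     finite V \<and> F \<subseteq> Pow V \<and> uniform 3 F \<and> regular_on V k F \<and>
     linear_family F \<and> cover_free 2 F \<and> union_free 3 F"

text \<open>
  The vertex set is fixed to be \<^term>\<open>{..<n}\<close>; the definition is invariant under
  relabelling the vertices.
\<close>

definition exists_design3 :: "nat \<Rightarrow> nat \<Rightarrow> bool" where
  "exists_design3 n k \<longleftrightarrow> (\<exists>F. optimal_superimposed_design3 {..<n} k F)"

text \<open>
  The number \<open>k'(3, n)\<close>. For \<open>n > 0\<close> it is a genuine maximum, see \<open>kprime3_is_max\<close> below;
  for \<open>n = 0\<close> the set of admissible \<open>k\<close> is unbounded and the value is meaningless.
\<close>

definition kprime3 :: "nat \<Rightarrow> nat" where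
  "kprime3 n = Max {k. exists_design3 n k}"

lemma exists_design3_0: "exists_design3 n 0"
  unfolding exists_design3_def optimal_superimposed_design3_def uniform_def regular_on_def
    linear_family_def cover_free_def union_free_def
  by (rule exI[of _ "{}"]) simp

lemma exists_design3_bound:
  assumes "n > 0" "exists_design3 n k"
  shows "k \<le> 2 ^ n"
proof -
  from assms(2) obtain F where F: "F \<subseteq> Pow {..<n}" "regular_on {..<n} k F"
    unfolding exists_design3_def optimal_superimposed_design3_def by blast
  have "k = card {A \<in> F. 0 \<in> A}"
    using F(2) assms(1) by (auto simp: regular_on_def)
  also have "\<dots> \<le> card (Pow {..<n})"
    using F(1) by (intro card_mono) auto
  finally show ?thesis by (simp add: card_Pow)
qed

lemma finite_exists_design3: "n > 0 \<Longrightarrow> finite {k. exists_design3 n k}"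
  by (rule finite_subset[of _ "{..2 ^ n}"]) (use exists_design3_bound in blast)+

lemma kprime3_is_max:
  assumes "n > 0"
  shows "exists_design3 n (kprime3 n)" "exists_design3 n k \<Longrightarrow> k \<le> kprime3 n"
proof -
  note fin = finite_exists_design3[OF assms]
  have "{k. exists_design3 n k} \<noteq> {}"
    using exists_design3_0 by blast
  from Max_in[OF fin this] show "exists_design3 n (kprime3 n)"
    by (simp add: kprime3_def)
  show "k \<le> kprime3 n" if "exists_design3 n k"
    unfolding kprime3_def using that by (intro Max_ge[OF fin]) simp
qed

end

theory Submission
  imports Defs "HOL-Library.FuncSet" "HOL-Number_Theory.Cong"
begin

text \<open>
  Write \<open>n = 3 m\<close> and take as vertices three disjoint copies of \<open>\<int>/m\<close>.  For a set
  \<open>S\<close> of pairs \<open>(a, b)\<close> of residues let the edges be all triples \<open>(x, x + a, x + b)\<close>, one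
  coordinate in each copy, with \<open>(a, b) \<in> S\<close>.  Each pair contributes a perfect matching, so the
  hypergraph is regular of degree \<open>card S\<close> for every \<open>m\<close>, and passing to a subset of \<open>S\<close> gives
  every smaller degree.  It remains to find a large \<open>S\<close> for which the hypergraph has no
  forbidden configuration.

  A linear triple system is automatically 2-cover-free.  It is 3-union-free if it contains neither
  a \<^emph>\<open>twin triangle\<close> (two edges through a common point, and two further edges that join
  the remaining points crosswise) nor a 3 by 3 grid; this is \<open>triples_determined_by_union\<close>.  For
  the hypergraph of \<open>S\<close> these two configurations, and the failures of linearity, become linear
  congruences between few members of \<open>S\<close>:

  \<^item> twin triangles, and grids that use one pair of \<open>S\<close> twice, need four distinct members of
    \<open>S\<close> with two congruences, or two distinct members with one congruence;
  \<^item> all other grids need six distinct members with four congruences;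
  \<^item> failures of linearity need two distinct members with one congruence.

  Hence among the \<open>m\<^sup>2\<close> pairs there are at most \<open>6 m\<^sup>3\<close> bad pairs, \<open>4 m\<^sup>6\<close> bad quadruples and
  \<open>m\<^sup>8\<close> bad sextuples.  In a random sample of \<open>K\<close> elements the expected number of bad tuples is
  at most \<open>6 K\<^sup>2 / m + 4 K\<^sup>4 / m\<^sup>2 + K\<^sup>6 / m\<^sup>4\<close>.  If \<open>K\<close> is about \<open>m powr (2 / 3) / 5\<close>, this
  is a small fraction of \<open>K\<close> for large \<open>m\<close>, and deleting one element of each bad tuple leaves comfortably more
  than \<open>n powr (2 / 3) / 25\<close> elements (\<open>deletion_method\<close>, \<open>exists_generic\<close>,
  \<open>design_of_small_degree\<close>).  The exponent \<open>2 / 3\<close> is where the term for quadruples becomes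
  comparable with \<open>K\<close>.
\<close>

section \<open>The deletion method\<close>

lemma card_functions_with_prescribed_values:
  assumes "finite V" "finite \<Omega>" "distinct is" "set is \<subseteq> V"
  shows "card {f \<in> V \<rightarrow>\<^sub>E \<Omega>. map f is = l} * card \<Omega> ^ length is \<le> card \<Omega> ^ card V"
proof -
  let ?R = "{f \<in> V \<rightarrow>\<^sub>E \<Omega>. map f is = l}"
  have len: "length is = card (set is)" "card (set is) \<le> card V"
    using assms by (simp add: distinct_card, intro card_mono)
  have inj: "inj_on (\<lambda>f. restrict f (V - set is)) ?R"
  proof (rule inj_onI)
    fix f g assume fg: "f \<in> ?R" "g \<in> ?R"
      and eq: "restrict f (V - set is) = restrict g (V - set is)"
    have "f i = g i" if "i \<in> V" for i
    proof (cases "i \<in> set is")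
      case True
      with fg show ?thesis by (metis (mono_tags, lifting) map_eq_conv mem_Collect_eq)
    next
      case False
      with eq that show ?thesis by (metis DiffI restrict_apply')
    qed
    with fg show "f = g" by (auto intro: PiE_ext)
  qed
  have "card ?R \<le> card ((V - set is) \<rightarrow>\<^sub>E \<Omega>)"
    by (rule card_inj_on_le[OF inj]) (use assms in \<open>auto intro!: finite_PiE\<close>)
  also have "\<dots> = card \<Omega> ^ (card V - length is)"
    using assms len by (simp add: card_PiE card_Diff_subset)
  finally have "card ?R * card \<Omega> ^ length is
      \<le> card \<Omega> ^ (card V - length is) * card \<Omega> ^ length is"
    by simp
  also have "\<dots> = card \<Omega> ^ card V"
    using len by (simp flip: power_add)
  finally show ?thesis .
qed

text \<open>
  The deletion (alteration) method.  Average over all functions \<open>f\<close> from \<open>{..<K}\<close> to \<open>\<Omega>\<close>: a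
  fixed list \<open>l\<close> is the image of a list of distinct indices in expectation at most
  \<open>(K / card \<Omega>) ^ length l\<close> times.  So some \<open>f\<close> hits bad lists at most \<open>L\<close> times, and removing
  the first index of every hit leaves an index set on which \<open>f\<close> hits none.  Counting the lists
  \<open>[s, s]\<close> as bad makes \<open>f\<close> injective on the remaining indices.
\<close>

lemma deletion_method:
  fixes \<Omega> :: "'a set" and Bad :: "'a list set" and L :: real
  assumes fin: "finite \<Omega>" "\<Omega> \<noteq> {}" "finite Bad"
    and nonempty: "[] \<notin> Bad"
    and diag: "\<And>s. s \<in> \<Omega> \<Longrightarrow> [s, s] \<in> Bad"
    and weight: "(\<Sum>l\<in>Bad. (real K / real (card \<Omega>)) ^ length l) \<le> L"
  shows "\<exists>S\<subseteq>\<Omega>. real K - L \<le> real (card S) \<and> (\<forall>l\<in>Bad. set l \<subseteq> S \<longrightarrow> \<not> distinct l)"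
proof -
  define D where "D = {is. distinct is \<and> set is \<subseteq> {..<K}}"
  define \<F> where "\<F> = ({..<K} \<rightarrow>\<^sub>E \<Omega>)"
  define B where "B = (\<lambda>f. {is \<in> D. map f is \<in> Bad})"
  define N where "N = real (card \<Omega>)"
  have N: "N > 0" unfolding N_def using fin by (simp add: card_gt_0_iff)
  have finD: "finite D"
    unfolding D_def by (rule finite_subset_distinct[OF finite_lessThan, of K, THEN rev_finite_subset]) auto
  have fin\<F>: "finite \<F>" unfolding \<F>_def using fin by (auto intro: finite_PiE)
  have card\<F>: "real (card \<F>) = N ^ K"
    unfolding \<F>_def N_def by (simp add: card_PiE)
  have finB: "finite (B f)" for f unfolding B_def using finD by simp
  have le: "(\<Sum>is | is \<in> D \<and> length is = length l. real (card {f \<in> \<F>. map f is = l}))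
      \<le> (real K / N) ^ length l * N ^ K" for l
  proof -
    have one: "real (card {f \<in> \<F>. map f is = l}) \<le> N ^ K / N ^ length l"
      if "is \<in> D" "length is = length l" for "is"
    proof -
      have "card {f \<in> \<F>. map f is = l} * card \<Omega> ^ length is \<le> card \<Omega> ^ card {..<K}"
        unfolding \<F>_def using that fin
        by (intro card_functions_with_prescribed_values) (auto simp: D_def)
      then have "real (card {f \<in> \<F>. map f is = l}) * N ^ length l \<le> N ^ K"
        unfolding N_def that(2) by (simp flip: of_nat_power of_nat_mult)
      with N show ?thesis by (simp add: pos_le_divide_eq)
    qed
    have "card {is \<in> D. length is = length l} \<le> card {is. set is \<subseteq> {..<K} \<and> length is = length l}"
      by (intro card_mono finite_lists_length_eq) (auto simp: D_def)
    also have "\<dots> = K ^ length l" by (simp add: card_lists_length_eq)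
    finally have c: "real (card {is \<in> D. length is = length l}) \<le> real K ^ length l"
      by (simp flip: of_nat_power)
    have "(\<Sum>is | is \<in> D \<and> length is = length l. real (card {f \<in> \<F>. map f is = l}))
        \<le> (\<Sum>is | is \<in> D \<and> length is = length l. N ^ K / N ^ length l)"
      by (intro sum_mono one) auto
    also have "\<dots> = real (card {is \<in> D. length is = length l}) * (N ^ K / N ^ length l)"
      by simp
    also have "\<dots> \<le> real K ^ length l * (N ^ K / N ^ length l)"
      using c N by (intro mult_right_mono) auto
    finally show ?thesis by (simp add: power_divide field_simps)
  qed
  have cardB: "real (card (B f)) = (\<Sum>is\<in>D. \<Sum>l\<in>Bad. if map f is = l then 1 else 0)" for f
    unfolding B_def using finD fin by (simp add: sum.If_cases Int_def conj_commute)
  have "(\<Sum>f\<in>\<F>. real (card (B f)))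
      = (\<Sum>l\<in>Bad. \<Sum>is\<in>D. \<Sum>f\<in>\<F>. if map f is = l then 1 else 0)"
    unfolding cardB by (subst sum.swap, subst (2) sum.swap, subst sum.swap) (rule refl)
  also have "\<dots> = (\<Sum>l\<in>Bad. \<Sum>is\<in>D. real (card {f \<in> \<F>. map f is = l}))"
    using fin\<F> by (simp add: sum.If_cases Int_def)
  also have "\<dots> = (\<Sum>l\<in>Bad. \<Sum>is | is \<in> D \<and> length is = length l. real (card {f \<in> \<F>. map f is = l}))"
  proof (rule sum.cong[OF refl], rule sum.mono_neutral_right, goal_cases)
    case (3 l)
    show ?case
    proof
      fix "is" assume "is \<in> D - {is \<in> D. length is = length l}"
      then have "{f \<in> \<F>. map f is = l} = {}" by auto
      then show "real (card {f \<in> \<F>. map f is = l}) = 0"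
        by (simp only: card.empty of_nat_0)
    qed
  qed (use finD in auto)
  also have "\<dots> \<le> (\<Sum>l\<in>Bad. (real K / N) ^ length l * N ^ K)"
    by (intro sum_mono le)
  also have "\<dots> \<le> L * N ^ K"
    unfolding sum_distrib_right[symmetric] using weight N
    by (intro mult_right_mono) (auto simp: N_def)
  finally have total: "(\<Sum>f\<in>\<F>. real (card (B f))) \<le> L * real (card \<F>)"
    by (simp add: card\<F>)
  have "\<exists>f\<in>\<F>. real (card (B f)) \<le> L"
  proof (rule ccontr)
    assume "\<not> ?thesis"
    moreover have "\<F> \<noteq> {}" using fin unfolding \<F>_def by (simp add: PiE_eq_empty_iff)
    ultimately have "(\<Sum>f\<in>\<F>. L) < (\<Sum>f\<in>\<F>. real (card (B f)))"
      using fin\<F> by (intro sum_strict_mono) auto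
    with total show False by (simp add: mult.commute)
  qed
  then obtain f where f: "f \<in> \<F>" "real (card (B f)) \<le> L" by blast
  define I where "I = {..<K} - hd ` B f"
  have good: "map f is \<notin> Bad" if "distinct is" "set is \<subseteq> I" for "is"
  proof
    assume bad: "map f is \<in> Bad"
    with that have "is \<in> B f" by (auto simp: B_def D_def I_def)
    then have "hd is \<notin> I" by (simp add: I_def)
    moreover have "hd is \<in> set is" using bad nonempty by (cases "is") auto
    ultimately show False using that by auto
  qed
  have fI: "f i \<in> \<Omega>" if "i \<in> I" for i using f that by (auto simp: \<F>_def I_def)
  have inj: "inj_on f I"
  proof (rule inj_onI, rule ccontr)
    fix i j assume ij: "i \<in> I" "j \<in> I" "f i = f j" "i \<noteq> j"
    with good[of "[i, j]"] diag[OF fI[of i]] show False by simp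
  qed
  have "real K - L \<le> real (card {..<K}) - real (card (hd ` B f))"
    using card_image_le[OF finB, of hd f] f by simp
  also have "\<dots> \<le> real (card I)"
    unfolding I_def using diff_card_le_card_Diff[of "hd ` B f" "{..<K}"] finB by simp
  finally have "real K - L \<le> real (card (f ` I))" by (simp add: card_image inj)
  moreover have "\<not> distinct l" if l: "l \<in> Bad" "set l \<subseteq> f ` I" for l
  proof
    assume "distinct l"
    define "is" where "is = map (the_inv_into I f) l"
    have "map f is = l"
      unfolding is_def using l by (auto intro!: map_idI f_the_inv_into_f[OF inj])
    moreover have "set is \<subseteq> I"
      unfolding is_def using l by (auto intro!: the_inv_into_into[OF inj])
    moreover from \<open>map f is = l\<close> \<open>distinct l\<close> have "distinct is"
      by (metis distinct_map)
    ultimately show False using good[of "is"] l by simp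
  qed
  moreover have "f ` I \<subseteq> \<Omega>" using fI by auto
  ultimately show ?thesis by blast
qed

section \<open>Three-partite triple systems\<close>

definition linear_triples :: "('a \<times> 'b \<times> 'c) set \<Rightarrow> bool" where
  "linear_triples T \<longleftrightarrow>
     (\<forall>x y z z'. (x, y, z) \<in> T \<and> (x, y, z') \<in> T \<longrightarrow> z = z') \<and>
     (\<forall>x y z y'. (x, y, z) \<in> T \<and> (x, y', z) \<in> T \<longrightarrow> y = y') \<and>
     (\<forall>x y z x'. (x, y, z) \<in> T \<and> (x', y, z) \<in> T \<longrightarrow> x = x')"

lemma linear_triplesD:
  assumes "linear_triples T"
  shows "(x, y, z) \<in> T \<Longrightarrow> (x, y, z') \<in> T \<Longrightarrow> z = z'"
    and "(x, y, z) \<in> T \<Longrightarrow> (x, y', z) \<in> T \<Longrightarrow> y = y'"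
    and "(x, y, z) \<in> T \<Longrightarrow> (x', y, z) \<in> T \<Longrightarrow> x = x'"
  using assms unfolding linear_triples_def by blast+

text \<open>
  Two edges through a common point \<open>p\<close>, and two edges crossing between their remaining points:
  together with either of the latter the first two form a triangle.  The three clauses correspond
  to the part of the vertex set that contains \<open>p\<close>.
\<close>

definition twin_triangle_free :: "('a \<times> 'b \<times> 'c) set \<Rightarrow> bool" where
  "twin_triangle_free T \<longleftrightarrow>
     (\<forall>x y z y' z' u u'. (x, y, z) \<in> T \<and> (x, y', z') \<in> T \<and> (u, y, z') \<in> T \<and> (u', y', z) \<in> T
        \<longrightarrow> y = y') \<and>
     (\<forall>x y z x' z' u u'. (x, y, z) \<in> T \<and> (x', y, z') \<in> T \<and> (x, u, z') \<in> T \<and> (x', u', z) \<in> T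
        \<longrightarrow> x = x') \<and>
     (\<forall>x y z x' y' u u'. (x, y, z) \<in> T \<and> (x', y', z) \<in> T \<and> (x, y', u) \<in> T \<and> (x', y, u') \<in> T
        \<longrightarrow> x = x')"

text \<open>
  In a 3 by 3 grid the rows and the columns are edges.  Every row and every column meets the three
  parts once, so the parts form a Latin square of order 3; such a square is cyclic up to
  relabelling, which gives the shape below.  In a linear system distinct first coordinates already
  make all nine points distinct.
\<close>

definition grid_free :: "('a \<times> 'b \<times> 'c) set \<Rightarrow> bool" where
  "grid_free T \<longleftrightarrow>
     (\<forall>x0 y0 z0 x1 y1 z1 x2 y2 z2.
        (x0, y0, z0) \<in> T \<and> (x1, y1, z1) \<in> T \<and> (x2, y2, z2) \<in> T \<and>
        (x0, y1, z2) \<in> T \<and> (x1, y2, z0) \<in> T \<and> (x2, y0, z1) \<in> T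
        \<longrightarrow> x0 = x1 \<or> x0 = x2 \<or> x1 = x2)"

definition covers :: "('a \<times> 'b \<times> 'c) set \<Rightarrow> 'a \<times> 'b \<times> 'c \<Rightarrow> bool" where
  "covers \<B> = (\<lambda>(x, y, z). (\<exists>y' z'. (x, y', z') \<in> \<B>) \<and> (\<exists>x' z'. (x', y, z') \<in> \<B>) \<and>
     (\<exists>x' y'. (x', y', z) \<in> \<B>))"

text \<open>
  An edge outside a family of at most three edges can lie in the union of the family only if its
  three points are covered by three different members: by linearity one member cannot cover two of
  them.
\<close>

lemma covers_cases:
  assumes lin: "linear_triples T" and "\<B> \<subseteq> T" "(x, y, z) \<in> T" "(x, y, z) \<notin> \<B>"
    and "covers \<B> (x, y, z)" "finite \<B>" "card \<B> \<le> 3"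
  obtains y1 z1 x2 z2 x3 y3 where "\<B> = {(x, y1, z1), (x2, y, z2), (x3, y3, z)}"
    "y1 \<noteq> y" "z1 \<noteq> z" "x2 \<noteq> x" "z2 \<noteq> z" "x3 \<noteq> x" "y3 \<noteq> y"
proof -
  from assms(5) obtain y1 z1 x2 z2 x3 y3
    where B: "(x, y1, z1) \<in> \<B>" "(x2, y, z2) \<in> \<B>" "(x3, y3, z) \<in> \<B>"
    unfolding covers_def by blast
  have ne: "y1 \<noteq> y" "z1 \<noteq> z" "x2 \<noteq> x" "z2 \<noteq> z" "x3 \<noteq> x" "y3 \<noteq> y"
  proof -
    have T: "(x, y1, z1) \<in> T" "(x2, y, z2) \<in> T" "(x3, y3, z) \<in> T" using B assms(2) by auto
    note lin3 = linear_triplesD[OF lin assms(3)]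
    show "y1 \<noteq> y" using lin3(1)[of z1] T B assms(4) by auto
    show "z1 \<noteq> z" using lin3(2)[of y1] T B assms(4) by auto
    show "x2 \<noteq> x" using lin3(1)[of z2] T B assms(4) by auto
    show "z2 \<noteq> z" using lin3(3)[of x2] T B assms(4) by auto
    show "x3 \<noteq> x" using lin3(2)[of y3] T B assms(4) by auto
    show "y3 \<noteq> y" using lin3(3)[of x3] T B assms(4) by auto
  qed
  have "card {(x, y1, z1), (x2, y, z2), (x3, y3, z)} = 3"
    using ne by simp
  then have "{(x, y1, z1), (x2, y, z2), (x3, y3, z)} = \<B>"
    using B assms(6,7) by (intro card_seteq) simp_all
  from that[OF this[symmetric] ne] show ?thesis .
qed

text \<open>
  Suppose that \<open>A = (x, y, z)\<close> is in \<open>\<A>\<close> but not in \<open>\<B>\<close>.  Then \<open>\<B>\<close> consists of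
  three edges \<open>P\<close>, \<open>Q\<close>, \<open>R\<close> through \<open>x\<close>, \<open>y\<close>, \<open>z\<close> respectively.  If at least one of
  them also belongs to \<open>\<A>\<close>, then the coverage of the others forces a twin triangle.  If none
  does, the three edges of \<open>\<A>\<close> and the three of \<open>\<B>\<close> are pairwise incident, and their
  points of intersection either repeat the pattern of a twin triangle or fill a grid.
\<close>

lemma triples_subset_of_union_eq:
  assumes lin: "linear_triples T" and tw: "twin_triangle_free T" and gr: "grid_free T"
    and sub: "\<A> \<subseteq> T" "\<B> \<subseteq> T"
    and card: "finite \<A>" "card \<A> \<le> 3" "finite \<B>" "card \<B> \<le> 3"
    and cov: "\<And>A. A \<in> \<A> \<Longrightarrow> covers \<B> A" "\<And>B. B \<in> \<B> \<Longrightarrow> covers \<A> B"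
  shows "\<A> \<subseteq> \<B>"
proof (rule ccontr)
  assume "\<not> \<A> \<subseteq> \<B>"
  then obtain x y z where A: "(x, y, z) \<in> \<A>" "(x, y, z) \<notin> \<B>"
    by (metis prod_cases3 subsetI)
  obtain y1 z1 x2 z2 x3 y3 where \<B>: "\<B> = {(x, y1, z1), (x2, y, z2), (x3, y3, z)}"
    and ne: "y1 \<noteq> y" "z1 \<noteq> z" "x2 \<noteq> x" "z2 \<noteq> z" "x3 \<noteq> x" "y3 \<noteq> y"
    by (rule covers_cases[OF lin sub(2) subsetD[OF sub(1) A(1)] A(2) cov(1)[OF A(1)] card(3,4)])
  have inT: "(x, y, z) \<in> T" "(x, y1, z1) \<in> T" "(x2, y, z2) \<in> T" "(x3, y3, z) \<in> T"
    using A sub \<B> by auto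
  have tw1: "q = q'" if "(p, q, r) \<in> T" "(p, q', r') \<in> T" "(u, q, r') \<in> T" "(u', q', r) \<in> T"
    for p q r q' r' u u' using tw[unfolded twin_triangle_free_def, THEN conjunct1] that by blast
  have tw2: "p = p'" if "(p, q, r) \<in> T" "(p', q, r') \<in> T" "(p, u, r') \<in> T" "(p', u', r) \<in> T"
    for p q r p' r' u u' using tw[unfolded twin_triangle_free_def, THEN conjunct2, THEN conjunct1] that by blast
  have tw3: "p = p'" if "(p, q, r) \<in> T" "(p', q', r) \<in> T" "(p, q', u) \<in> T" "(p', q, u') \<in> T"
    for p q r p' q' u u' using tw[unfolded twin_triangle_free_def, THEN conjunct2, THEN conjunct2] that by blast
  note lin3 = linear_triplesD[OF lin]
  consider (PQ) "(x, y1, z1) \<in> \<A>" "(x2, y, z2) \<in> \<A>"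
    | (PR) "(x, y1, z1) \<in> \<A>" "(x3, y3, z) \<in> \<A>"
    | (QR) "(x2, y, z2) \<in> \<A>" "(x3, y3, z) \<in> \<A>"
    | (P) "(x, y1, z1) \<in> \<A>" "(x2, y, z2) \<notin> \<A>" "(x3, y3, z) \<notin> \<A>"
    | (Q) "(x, y1, z1) \<notin> \<A>" "(x2, y, z2) \<in> \<A>" "(x3, y3, z) \<notin> \<A>"
    | (R) "(x, y1, z1) \<notin> \<A>" "(x2, y, z2) \<notin> \<A>" "(x3, y3, z) \<in> \<A>"
    | (none) "(x, y1, z1) \<notin> \<A>" "(x2, y, z2) \<notin> \<A>" "(x3, y3, z) \<notin> \<A>"
    by argo
  then show False
  proof cases
    case PQ
    have \<A>: "\<A> = {(x, y, z), (x, y1, z1), (x2, y, z2)}"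
      using PQ A ne card by (intro card_seteq[symmetric]) auto
    have "covers \<A> (x3, y3, z)" using cov \<B> by auto
    with \<A> ne have "x3 = x2" "y3 = y1" by (auto simp: covers_def)
    with inT tw3[of x y z x3 y3 z1 z2] ne show False by auto
  next
    case PR
    have \<A>: "\<A> = {(x, y, z), (x, y1, z1), (x3, y3, z)}"
      using PR A ne card by (intro card_seteq[symmetric]) auto
    have "covers \<A> (x2, y, z2)" using cov \<B> by auto
    with \<A> ne have "x2 = x3" "z2 = z1" by (auto simp: covers_def)
    with inT tw2[of x y z x2 z2 y1 y3] ne show False by auto
  next
    case QR
    have \<A>: "\<A> = {(x, y, z), (x2, y, z2), (x3, y3, z)}"
      using QR A ne card by (intro card_seteq[symmetric]) auto
    have "covers \<A> (x, y1, z1)" using cov \<B> by auto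
    with \<A> ne have "y1 = y3" "z1 = z2" by (auto simp: covers_def)
    with inT tw1[of x y z y1 z1 x2 x3] ne show False by auto
  next
    case P
    have cQ: "covers \<A> (x2, y, z2)" and cR: "covers \<A> (x3, y3, z)" using cov \<B> by auto
    from cQ obtain y' z' where A': "(x2, y', z') \<in> \<A>" unfolding covers_def by blast
    have \<A>: "\<A> = {(x, y, z), (x, y1, z1), (x2, y', z')}"
      using P A A' ne card by (intro card_seteq[symmetric]) auto
    have A'T: "(x2, y', z') \<in> T" using A' sub by auto
    have "x3 = x2" using cR ne unfolding \<A> covers_def by auto
    moreover have "y3 \<noteq> y'" using lin3(1)[OF inT(4), of z'] A' A'T P(3) \<open>x3 = x2\<close> by auto
    then have "y3 = y1" using cR ne unfolding \<A> covers_def by auto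
    moreover have "z2 \<noteq> z'" using lin3(2)[OF inT(3), of y'] A' A'T P(2) by auto
    then have "z2 = z1" using cQ ne unfolding \<A> covers_def by auto
    ultimately show False using inT tw1[of x y z y1 z1 x2 x3] ne by auto
  next
    case Q
    have cP: "covers \<A> (x, y1, z1)" and cR: "covers \<A> (x3, y3, z)" using cov \<B> by auto
    from cP obtain x' z' where A': "(x', y1, z') \<in> \<A>" unfolding covers_def by blast
    have \<A>: "\<A> = {(x, y, z), (x2, y, z2), (x', y1, z')}"
      using Q A A' ne card by (intro card_seteq[symmetric]) auto
    have A'T: "(x', y1, z') \<in> T" using A' sub by auto
    have "y3 = y1" using cR ne unfolding \<A> covers_def by auto
    moreover have "x3 \<noteq> x'" using lin3(1)[OF inT(4), of z'] A' A'T Q(3) \<open>y3 = y1\<close> by auto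
    then have "x3 = x2" using cR ne unfolding \<A> covers_def by auto
    moreover have "z1 \<noteq> z'" using lin3(3)[OF inT(2), of x'] A' A'T Q(1) by auto
    then have "z1 = z2" using cP ne unfolding \<A> covers_def by auto
    ultimately show False using inT tw2[of x y z x2 z2 y1 y3] ne by auto
  next
    case R
    have cP: "covers \<A> (x, y1, z1)" and cQ: "covers \<A> (x2, y, z2)" using cov \<B> by auto
    from cP obtain x' y' where A': "(x', y', z1) \<in> \<A>" unfolding covers_def by blast
    have \<A>: "\<A> = {(x, y, z), (x3, y3, z), (x', y', z1)}"
      using R A A' ne card by (intro card_seteq[symmetric]) auto
    have A'T: "(x', y', z1) \<in> T" using A' sub by auto
    have "z2 = z1" using cQ ne unfolding \<A> covers_def by auto
    moreover have "x2 \<noteq> x'" using lin3(2)[OF inT(3), of y'] A' A'T R(2) \<open>z2 = z1\<close> by auto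
    then have "x2 = x3" using cQ ne unfolding \<A> covers_def by auto
    moreover have "y1 \<noteq> y'" using lin3(3)[OF inT(2), of x'] A' A'T R(1) by auto
    then have "y1 = y3" using cP ne unfolding \<A> covers_def by auto
    ultimately show False using inT tw3[of x y z x3 y3 z1 z2] ne by auto
  next
    case none
    have cP: "covers \<A> (x, y1, z1)" and cQ: "covers \<A> (x2, y, z2)"
      and cR: "covers \<A> (x3, y3, z)" using cov \<B> by auto
    \<comment> \<open>The other two edges of \<open>\<A>\<close> are named after the points of \<open>P\<close> that they cover.\<close>
    from cP obtain x' z' where A': "(x', y1, z') \<in> \<A>" unfolding covers_def by blast
    from cP obtain x'' y'' where A'': "(x'', y'', z1) \<in> \<A>" unfolding covers_def by blast
    have inT': "(x', y1, z') \<in> T" "(x'', y'', z1) \<in> T" using A' A'' sub by auto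
    have dis: "x' \<noteq> x" "x'' \<noteq> x" "z' \<noteq> z1" "y'' \<noteq> y1"
      using lin3 inT(2) inT' A' A'' none(1) by metis+
    then have \<A>: "\<A> = {(x, y, z), (x', y1, z'), (x'', y'', z1)}"
      using A A' A'' ne card by (intro card_seteq[symmetric]) auto
    have x2: "x2 = x' \<or> x2 = x''" and z2: "z2 = z' \<or> z2 = z1"
      and x3: "x3 = x' \<or> x3 = x''" and y3: "y3 = y1 \<or> y3 = y''"
      using cQ cR ne unfolding \<A> covers_def by auto
    have x2z2: "\<not> (x2 = x' \<and> z2 = z')" "\<not> (x2 = x'' \<and> z2 = z1)"
      and x3y3: "\<not> (x3 = x' \<and> y3 = y1)" "\<not> (x3 = x'' \<and> y3 = y'')"
      using lin3 inT(3,4) inT' A' A'' none(2,3) by metis+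
    \<comment> \<open>\<open>Q\<close> and \<open>R\<close> each take one point from either edge; only the last choice is a grid.\<close>
    consider "x2 = x'" "z2 = z1" | "x2 = x''" "z2 = z'" "x3 = x''" "y3 = y1"
      | "x2 = x''" "z2 = z'" "x3 = x'" "y3 = y''"
      using x2 z2 x3 y3 x2z2 x3y3 by blast
    then show False
    proof cases
      case 1
      have "covers \<B> (x', y1, z')" using cov A' by auto
      with dis 1 have "z' = z" by (auto simp: \<B> covers_def)
      with 1 inT inT' tw3[of x y z x' y1 z1 z1] dis show False by auto
    next
      case 2
      with inT inT' tw1[of x'' y z' y1 z x x'] ne show False by auto
    next
      case 3
      have "x' \<noteq> x''" using 3 lin3(2) inT(3) inT'(1) A' none(2) by metis
      with 3 inT inT' dis gr[unfolded grid_free_def, rule_format, of x y z x' y1 z' x'' y'' z1] show False by auto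
    qed
  qed
qed

lemma triples_determined_by_union:
  assumes "linear_triples T" "twin_triangle_free T" "grid_free T"
    and "\<A> \<subseteq> T" "\<B> \<subseteq> T" "finite \<A>" "card \<A> \<le> 3" "finite \<B>" "card \<B> \<le> 3"
    and "\<And>A. A \<in> \<A> \<Longrightarrow> covers \<B> A" "\<And>B. B \<in> \<B> \<Longrightarrow> covers \<A> B"
  shows "\<A> = \<B>"
  using triples_subset_of_union_eq[of T \<A> \<B>] triples_subset_of_union_eq[of T \<B> \<A>] assms
  by blast

text \<open>
  The three copies of \<open>{..<m}\<close> are laid out consecutively, so that the vertex set is
  \<open>{..<3 * m}\<close>.
\<close>

definition edge :: "nat \<Rightarrow> nat \<times> nat \<times> nat \<Rightarrow> nat set" where
  "edge m = (\<lambda>(x, y, z). {x, m + y, 2 * m + z})"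

definition box :: "nat \<Rightarrow> (nat \<times> nat \<times> nat) set" where
  "box m = {..<m} \<times> {..<m} \<times> {..<m}"

lemma mem_Union_edge:
  assumes "\<A> \<subseteq> box m" "i < m"
  shows "i \<in> \<Union> (edge m ` \<A>) \<longleftrightarrow> (\<exists>y z. (i, y, z) \<in> \<A>)"
    and "m + i \<in> \<Union> (edge m ` \<A>) \<longleftrightarrow> (\<exists>x z. (x, i, z) \<in> \<A>)"
    and "2 * m + i \<in> \<Union> (edge m ` \<A>) \<longleftrightarrow> (\<exists>x y. (x, y, i) \<in> \<A>)"
  using assms unfolding box_def edge_def by fastforce+

lemma edge_inj: "inj_on (edge m) (box m)"
proof (rule inj_onI)
  fix A B assume AB: "A \<in> box m" "B \<in> box m" "edge m A = edge m B"
  obtain x y z x' y' z' where eqs: "A = (x, y, z)" "B = (x', y', z')" by (metis prod_cases3)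
  with AB have lt: "x < m" "y < m" "z < m" "x' < m" "y' < m" "z' < m"
    by (auto simp: box_def)
  from AB(3) have "{x, m + y, 2 * m + z} = {x', m + y', 2 * m + z'}"
    by (simp add: eqs edge_def)
  then have "x \<in> {x', m + y', 2 * m + z'}" "m + y \<in> {x', m + y', 2 * m + z'}"
    "2 * m + z \<in> {x', m + y', 2 * m + z'}" by blast+
  with lt show "A = B" by (auto simp: eqs)
qed

lemma covers_of_union_eq:
  assumes "\<A> \<subseteq> box m" "\<B> \<subseteq> box m" "\<Union> (edge m ` \<A>) = \<Union> (edge m ` \<B>)" "A \<in> \<A>"
  shows "covers \<B> A"
proof -
  obtain x y z where A: "A = (x, y, z)" by (metis prod_cases3)
  with assms have lt: "x < m" "y < m" "z < m" by (auto simp: box_def)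
  have "edge m A \<subseteq> \<Union> (edge m ` \<B>)" using assms(3,4) by blast
  then have "x \<in> \<Union> (edge m ` \<B>)" "m + y \<in> \<Union> (edge m ` \<B>)" "2 * m + z \<in> \<Union> (edge m ` \<B>)"
    by (auto simp only: A edge_def)
  with mem_Union_edge(1)[OF assms(2) lt(1)] mem_Union_edge(2)[OF assms(2) lt(2)]
    mem_Union_edge(3)[OF assms(2) lt(3)]
  show ?thesis unfolding covers_def A prod.case by blast
qed

lemma union_free_edges:
  assumes "linear_triples T" "twin_triangle_free T" "grid_free T" "T \<subseteq> box m"
  shows "union_free 3 (edge m ` T)"
  unfolding union_free_def
proof (intro allI impI notI, elim conjE)
  fix \<A> \<B>
  assume sub: "\<A> \<subseteq> edge m ` T" "\<B> \<subseteq> edge m ` T"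
    and ne: "\<A> \<noteq> \<B>" and card: "0 < card \<A>" "card \<A> \<le> 3" "0 < card \<B>" "card \<B> \<le> 3"
    and eq: "\<Union>\<A> = \<Union>\<B>"
  from sub obtain A B where AB: "A \<subseteq> T" "\<A> = edge m ` A" "B \<subseteq> T" "\<B> = edge m ` B"
    by (meson subset_imageE)
  have inj: "inj_on (edge m) A" "inj_on (edge m) B"
    using edge_inj AB assms(4) by (meson inj_on_subset order_trans)+
  from card have "finite \<A>" "finite \<B>" by (auto intro: card_ge_0_finite)
  then have fin: "finite A" "finite B" using inj AB by (auto dest: finite_imageD)
  have "A = B"
  proof (rule triples_determined_by_union[OF assms(1-3) AB(1,3)])
    show "card A \<le> 3" "card B \<le> 3" using card AB inj by (auto simp: card_image)
    have box: "A \<subseteq> box m" "B \<subseteq> box m" using AB assms(4) by auto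
    show "covers B X" if "X \<in> A" for X
      using covers_of_union_eq[OF box _ that] eq AB by blast
    show "covers A X" if "X \<in> B" for X
      using covers_of_union_eq[OF box(2,1) _ that] eq AB by blast
  qed (fact fin)+
  with AB ne show False by simp
qed

lemma card_edge: "A \<in> box m \<Longrightarrow> finite (edge m A) \<and> card (edge m A) = 3"
  by (auto simp: box_def edge_def)

lemma linear_edges:
  assumes "linear_triples T" "T \<subseteq> box m"
  shows "linear_family (edge m ` T)"
  unfolding linear_family_def
proof (intro ballI impI, elim imageE, simp only:)
  fix P Q assume T: "P \<in> T" "Q \<in> T" and ne: "edge m P \<noteq> edge m Q"
  obtain x y z x' y' z' where PQ: "P = (x, y, z)" "Q = (x', y', z')" by (metis prod_cases3)
  have lt: "x < m" "y < m" "z < m" "x' < m" "y' < m" "z' < m"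
    using T PQ assms(2) by (auto simp: box_def)
  note lin3 = linear_triplesD[OF assms(1)]
  have two: "\<not> (x = x' \<and> y = y')" "\<not> (x = x' \<and> z = z')" "\<not> (y = y' \<and> z = z')"
    using T ne unfolding PQ by (metis lin3)+
  have "v = x \<and> x = x' \<or> v = m + y \<and> y = y' \<or> v = 2 * m + z \<and> z = z'"
    if "v \<in> edge m P \<inter> edge m Q" for v
    using that lt unfolding PQ edge_def by auto
  with two have "v = w" if "v \<in> edge m P \<inter> edge m Q" "w \<in> edge m P \<inter> edge m Q" for v w
    using that by metis
  moreover have "finite (edge m P \<inter> edge m Q)" unfolding PQ edge_def by simp
  ultimately show "finite (edge m P \<inter> edge m Q) \<and> card (edge m P \<inter> edge m Q) \<le> 1"
    unfolding One_nat_def by (meson card_le_Suc0_iff_eq)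
qed

text \<open>
  Two edges meet a third one in at most one point each, and the third one has three points.
\<close>

lemma linear_imp_cover_free:
  assumes "linear_family F" "uniform 3 F"
  shows "cover_free 2 F"
  unfolding cover_free_def
proof (intro allI impI notI, elim conjE)
  fix A :: "nat \<Rightarrow> 'a set"
  assume inj: "inj_on A {0..2}" and F: "A ` {0..2} \<subseteq> F" and sub: "A 0 \<subseteq> (\<Union>i\<in>{1..2}. A i)"
  have ne: "A 0 \<noteq> A 1" "A 0 \<noteq> A 2" using inj_onD[OF inj, of 0 1] inj_onD[OF inj, of 0 2] by auto
  have mem: "A 0 \<in> F" "A 1 \<in> F" "A 2 \<in> F" using F by auto
  have "{1..2::nat} = {1, 2}" by auto
  with sub have "A 0 = (A 0 \<inter> A 1) \<union> (A 0 \<inter> A 2)" by auto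
  then have "card (A 0) \<le> card (A 0 \<inter> A 1) + card (A 0 \<inter> A 2)"
    by (metis card_Un_le)
  also have "\<dots> \<le> 1 + 1"
    using assms(1) ne mem unfolding linear_family_def by (intro add_mono) blast+
  finally show False using assms(2) mem by (auto simp: uniform_def)
qed

section \<open>Triple systems generated by translations\<close>

definition steps :: "nat \<Rightarrow> (int \<times> int) set" where
  "steps m = {0..<int m} \<times> {0..<int m}"

text \<open>
  The pair of \<open>S\<close> that generates a triple; it identifies the orbit of the triple under simultaneous
  translation of the three coordinates modulo \<open>m\<close>.
\<close>

definition step :: "nat \<Rightarrow> nat \<times> nat \<times> nat \<Rightarrow> int \<times> int" where
  "step m = (\<lambda>(x, y, z). ((int y - int x) mod int m, (int z - int x) mod int m))"

definition translates :: "nat \<Rightarrow> (int \<times> int) set \<Rightarrow> (nat \<times> nat \<times> nat) set" where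
  "translates m S = {P \<in> box m. step m P \<in> S}"

text \<open>
  The first three alternatives are the failures of linearity: equal differences between two fixed
  parts.  The last three are what remains of a bad quadruple when its third and fourth member
  coincide, or when two of the columns in a degenerate grid do.
\<close>

definition bad_pairs :: "nat \<Rightarrow> (int \<times> int) list set" where
  "bad_pairs m = {[(a, b), (a', b')] | a b a' b'. {(a, b), (a', b')} \<subseteq> steps m \<and>
     ([a = a'] (mod int m) \<or> [b = b'] (mod int m) \<or> [b - a = b' - a'] (mod int m) \<or>
      [a + b = a' + b'] (mod int m) \<or> [b - 2 * a = b' - 2 * a'] (mod int m) \<or>
      [2 * b - a = 2 * b' - a'] (mod int m))}"

text \<open>
  The first three alternatives are twin triangles with the common point in the first, second and
  third part: \<open>(a1, b1)\<close> and \<open>(a2, b2)\<close> generate the two edges through it, the other members the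
  crossing edges.  The fourth comes from a grid in which \<open>(a1, b1)\<close> generates two of the rows,
  at distance \<open>a2 - a1\<close> from each other, and the other three members generate the columns.
\<close>

definition bad_quadruples :: "nat \<Rightarrow> (int \<times> int) list set" where
  "bad_quadruples m = {[(a1, b1), (a2, b2), (a3, b3), (a4, b4)] | a1 b1 a2 b2 a3 b3 a4 b4.
     {(a1, b1), (a2, b2), (a3, b3), (a4, b4)} \<subseteq> steps m \<and>
     ([b3 - a3 = b2 - a1] (mod int m) \<and> [b4 - a4 = b1 - a2] (mod int m) \<or>
      [b3 = b1 - a1 + a2] (mod int m) \<and> [b4 = b2 - a2 + a1] (mod int m) \<or>
      [a3 = b1 - b2 + a2] (mod int m) \<and> [a4 = b2 - b1 + a1] (mod int m) \<or>
      [b3 - a3 = b1 - a1 + (a2 - a1)] (mod int m) \<and> [b4 = b1 - (a2 - a1)] (mod int m))}"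

text \<open>
  A grid with rows \<open>(ai, bi)\<close> and columns \<open>(ci, di)\<close>, up to translation.  If \<open>x0\<close>, \<open>x1\<close>,
  \<open>x2\<close> are the first coordinates of the rows, then \<open>x1 - x0 = c1 - a2\<close> and
  \<open>x2 - x1 = c2 - a3\<close>, and the congruences are the incidences that these leave.
\<close>

definition bad_sextuples :: "nat \<Rightarrow> (int \<times> int) list set" where
  "bad_sextuples m = {[(a1, b1), (a2, b2), (a3, b3), (c1, d1), (c2, d2), (c3, d3)] |
       a1 b1 a2 b2 a3 b3 c1 d1 c2 d2 c3 d3.
     {(a1, b1), (a2, b2), (a3, b3), (c1, d1), (c2, d2), (c3, d3)} \<subseteq> steps m \<and>
     [d2 = b1 - (c1 - a2)] (mod int m) \<and>
     [b3 = d1 - (c1 - a2 + c2 - a3)] (mod int m) \<and>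
     [c3 = a1 - (c1 - a2 + c2 - a3)] (mod int m) \<and>
     [d3 = b2 - (c2 - a3)] (mod int m)}"

definition generic :: "nat \<Rightarrow> (int \<times> int) set \<Rightarrow> bool" where
  "generic m S \<longleftrightarrow> S \<subseteq> steps m \<and>
     (\<forall>l \<in> bad_pairs m \<union> bad_quadruples m \<union> bad_sextuples m. set l \<subseteq> S \<longrightarrow> \<not> distinct l)"

lemma cong_nat_eqI: "[int x = int y] (mod int m) \<Longrightarrow> x < m \<Longrightarrow> y < m \<Longrightarrow> x = y"
  by (metis cong_int_iff cong_less_modulus_unique_nat)

lemma translatesE:
  assumes "(x, y, z) \<in> translates m S"
  obtains a b where "step m (x, y, z) = (a, b)" "(a, b) \<in> S"
    "[a = int y - int x] (mod int m)" "[b = int z - int x] (mod int m)" "x < m" "y < m" "z < m"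
  using assms that unfolding translates_def step_def box_def by (auto simp: cong_def)

text \<open>
  The edges generated by one pair form a matching: two translates that agree in one coordinate are
  equal.
\<close>

lemma step_eq_imp_eq:
  assumes "(x, y, z) \<in> translates m S" "(x', y', z') \<in> translates m S'"
    and eq: "step m (x, y, z) = step m (x', y', z')" and meet: "x = x' \<or> y = y' \<or> z = z'"
  shows "x = x' \<and> y = y' \<and> z = z'"
proof -
  obtain a b where 1: "step m (x, y, z) = (a, b)"
    "[a = int y - int x] (mod int m)" "[b = int z - int x] (mod int m)" "x < m" "y < m" "z < m"
    by (rule translatesE[OF assms(1)]) (rule that)
  obtain a' b' where 2: "step m (x', y', z') = (a', b')"
    "[a' = int y' - int x'] (mod int m)" "[b' = int z' - int x'] (mod int m)"
    "x' < m" "y' < m" "z' < m"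
    by (rule translatesE[OF assms(2)]) (rule that)
  have ab: "[a = a'] (mod int m)" "[b = b'] (mod int m)" using 1(1) 2(1) eq by simp_all
  note dvd = 1(2,3)[unfolded cong_iff_dvd_diff dvd_def] 2(2,3)[unfolded cong_iff_dvd_diff dvd_def]
    ab[unfolded cong_iff_dvd_diff dvd_def]
  have "[int x = int x'] (mod int m)"
    using meet
  proof (elim disjE)
    assume eq: "y = y'"
    show ?thesis using dvd unfolding eq cong_iff_dvd_diff dvd_def by algebra
  next
    assume eq: "z = z'"
    show ?thesis using dvd unfolding eq cong_iff_dvd_diff dvd_def by algebra
  qed simp
  moreover have "[int y = int y'] (mod int m)" "[int z = int z'] (mod int m)"
    using dvd calculation unfolding cong_iff_dvd_diff dvd_def by algebra+
  ultimately show ?thesis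
    using cong_nat_eqI 1(4-6) 2(4-6) by blast
qed

lemma generic_pair:
  assumes "generic m S" "(a, b) \<in> S" "(a', b') \<in> S"
    and "[a = a'] (mod int m) \<or> [b = b'] (mod int m) \<or> [b - a = b' - a'] (mod int m) \<or>
      [a + b = a' + b'] (mod int m) \<or> [b - 2 * a = b' - 2 * a'] (mod int m) \<or>
      [2 * b - a = 2 * b' - a'] (mod int m)"
  shows "a = a' \<and> b = b'"
proof -
  have "[(a, b), (a', b')] \<in> bad_pairs m"
    using assms unfolding bad_pairs_def generic_def by blast
  with assms(1-3) have "\<not> distinct [(a, b), (a', b')]"
    unfolding generic_def by (metis UnI1 empty_set list.simps(15) empty_subsetI insert_subset)
  then show ?thesis by simp
qed

lemma generic_quadruple:
  assumes "generic m S" "(a1, b1) \<in> S" "(a2, b2) \<in> S" "(a3, b3) \<in> S" "(a4, b4) \<in> S"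
    and "distinct [(a1, b1), (a2, b2), (a3, b3), (a4, b4)]"
  shows "\<not> ([b3 - a3 = b2 - a1] (mod int m) \<and> [b4 - a4 = b1 - a2] (mod int m))"
    and "\<not> ([b3 = b1 - a1 + a2] (mod int m) \<and> [b4 = b2 - a2 + a1] (mod int m))"
    and "\<not> ([a3 = b1 - b2 + a2] (mod int m) \<and> [a4 = b2 - b1 + a1] (mod int m))"
    and "\<not> ([b3 - a3 = b1 - a1 + (a2 - a1)] (mod int m) \<and> [b4 = b1 - (a2 - a1)] (mod int m))"
proof -
  let ?l = "[(a1, b1), (a2, b2), (a3, b3), (a4, b4)]"
  have "set ?l \<subseteq> S" using assms(2-5) by simp
  with assms(1,6) have l: "?l \<notin> bad_quadruples m" "set ?l \<subseteq> steps m" unfolding generic_def by blast+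
  then show "\<not> ([b3 - a3 = b2 - a1] (mod int m) \<and> [b4 - a4 = b1 - a2] (mod int m))"
    and "\<not> ([b3 = b1 - a1 + a2] (mod int m) \<and> [b4 = b2 - a2 + a1] (mod int m))"
    and "\<not> ([a3 = b1 - b2 + a2] (mod int m) \<and> [a4 = b2 - b1 + a1] (mod int m))"
    and "\<not> ([b3 - a3 = b1 - a1 + (a2 - a1)] (mod int m) \<and> [b4 = b1 - (a2 - a1)] (mod int m))"
    unfolding bad_quadruples_def by auto
qed

lemma generic_sextuple:
  assumes "generic m S" "set [(a1, b1), (a2, b2), (a3, b3), (c1, d1), (c2, d2), (c3, d3)] \<subseteq> S"
    and "distinct [(a1, b1), (a2, b2), (a3, b3), (c1, d1), (c2, d2), (c3, d3)]"
  shows "\<not> ([d2 = b1 - (c1 - a2)] (mod int m) \<and>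
     [b3 = d1 - (c1 - a2 + c2 - a3)] (mod int m) \<and>
     [c3 = a1 - (c1 - a2 + c2 - a3)] (mod int m) \<and>
     [d3 = b2 - (c2 - a3)] (mod int m))"
proof -
  let ?l = "[(a1, b1), (a2, b2), (a3, b3), (c1, d1), (c2, d2), (c3, d3)]"
  from assms have "?l \<notin> bad_sextuples m" "set ?l \<subseteq> steps m" unfolding generic_def by blast+
  then show ?thesis unfolding bad_sextuples_def by auto
qed

lemma translates_linear:
  assumes "generic m S"
  shows "linear_triples (translates m S)"
  unfolding linear_triples_def
proof (intro conjI allI impI; elim conjE)
  fix x y z z' assume T: "(x, y, z) \<in> translates m S" "(x, y, z') \<in> translates m S"
  obtain a b where 1: "step m (x, y, z) = (a, b)" "(a, b) \<in> S" "[a = int y - int x] (mod int m)"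
    by (rule translatesE[OF T(1)]) (rule that)
  obtain a' b' where 2: "step m (x, y, z') = (a', b')" "(a', b') \<in> S" "[a' = int y - int x] (mod int m)"
    by (rule translatesE[OF T(2)]) (rule that)
  have "[a = a'] (mod int m)" using 1(3) 2(3) by (metis cong_sym cong_trans)
  then have "a = a' \<and> b = b'" using generic_pair[OF assms 1(2) 2(2)] by blast
  then show "z = z'" using step_eq_imp_eq[OF T] 1 2 by simp
next
  fix x y z y' assume T: "(x, y, z) \<in> translates m S" "(x, y', z) \<in> translates m S"
  obtain a b where 1: "step m (x, y, z) = (a, b)" "(a, b) \<in> S" "[b = int z - int x] (mod int m)"
    by (rule translatesE[OF T(1)]) (rule that)
  obtain a' b' where 2: "step m (x, y', z) = (a', b')" "(a', b') \<in> S" "[b' = int z - int x] (mod int m)"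
    by (rule translatesE[OF T(2)]) (rule that)
  have "[b = b'] (mod int m)" using 1(3) 2(3) by (metis cong_sym cong_trans)
  then have "a = a' \<and> b = b'" using generic_pair[OF assms 1(2) 2(2)] by blast
  then show "y = y'" using step_eq_imp_eq[OF T] 1 2 by simp
next
  fix x y z x' assume T: "(x, y, z) \<in> translates m S" "(x', y, z) \<in> translates m S"
  obtain a b where 1: "step m (x, y, z) = (a, b)" "(a, b) \<in> S"
    "[a = int y - int x] (mod int m)" "[b = int z - int x] (mod int m)"
    by (rule translatesE[OF T(1)]) (rule that)
  obtain a' b' where 2: "step m (x', y, z) = (a', b')" "(a', b') \<in> S"
    "[a' = int y - int x'] (mod int m)" "[b' = int z - int x'] (mod int m)"
    by (rule translatesE[OF T(2)]) (rule that)
  have "[b - a = b' - a'] (mod int m)"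
    using 1(3,4) 2(3,4) unfolding cong_iff_dvd_diff dvd_def by algebra
  then have "a = a' \<and> b = b'" using generic_pair[OF assms 1(2) 2(2)] by blast
  then show "x = x'" using step_eq_imp_eq[OF T] 1 2 by simp
qed

text \<open>
  The incidences of a twin triangle are exactly the congruences of a bad quadruple, so only the
  four generating pairs have to be shown distinct.  Edges that meet have distinct generators because
  a generator yields a matching.  The two crossing edges need not meet, but equal generators for
  them would make the first two edges a bad pair.
\<close>

lemma translates_twin_triangle_free:
  assumes gen: "generic m S"
  shows "twin_triangle_free (translates m S)"
  unfolding twin_triangle_free_def
proof (intro conjI allI impI; elim conjE)
  note lin = linear_triplesD[OF translates_linear[OF gen]]
  fix x y z y' z' u u'
  assume T: "(x, y, z) \<in> translates m S" "(x, y', z') \<in> translates m S"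
    "(u, y, z') \<in> translates m S" "(u', y', z) \<in> translates m S"
  obtain a1 b1 where 1: "step m (x, y, z) = (a1, b1)" "(a1, b1) \<in> S"
    "[a1 = int y - int x] (mod int m)" "[b1 = int z - int x] (mod int m)"
    by (rule translatesE[OF T(1)]) (rule that)
  obtain a2 b2 where 2: "step m (x, y', z') = (a2, b2)" "(a2, b2) \<in> S"
    "[a2 = int y' - int x] (mod int m)" "[b2 = int z' - int x] (mod int m)"
    by (rule translatesE[OF T(2)]) (rule that)
  obtain a3 b3 where 3: "step m (u, y, z') = (a3, b3)" "(a3, b3) \<in> S"
    "[a3 = int y - int u] (mod int m)" "[b3 = int z' - int u] (mod int m)"
    by (rule translatesE[OF T(3)]) (rule that)
  obtain a4 b4 where 4: "step m (u', y', z) = (a4, b4)" "(a4, b4) \<in> S"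
    "[a4 = int y' - int u'] (mod int m)" "[b4 = int z - int u'] (mod int m)"
    by (rule translatesE[OF T(4)]) (rule that)
  have rel: "[b3 - a3 = b2 - a1] (mod int m)" "[b4 - a4 = b1 - a2] (mod int m)"
    using 1(3,4) 2(3,4) 3(3,4) 4(3,4) unfolding cong_iff_dvd_diff dvd_def by algebra+
  show "y = y'"
  proof (rule ccontr)
    assume ne: "y \<noteq> y'"
    have "(a1, b1) \<noteq> (a2, b2)" using step_eq_imp_eq[OF T(1,2)] 1(1) 2(1) ne by auto
    moreover have "(a1, b1) \<noteq> (a3, b3)"
      using step_eq_imp_eq[OF T(1,3)] 1(1) 3(1) ne lin(2)[OF T(1), of y'] T(2) by auto
    moreover have "(a1, b1) \<noteq> (a4, b4)" using step_eq_imp_eq[OF T(1,4)] 1(1) 4(1) ne by auto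
    moreover have "(a2, b2) \<noteq> (a3, b3)" using step_eq_imp_eq[OF T(2,3)] 2(1) 3(1) ne by auto
    moreover have "(a2, b2) \<noteq> (a4, b4)"
      using step_eq_imp_eq[OF T(2,4)] 2(1) 4(1) ne lin(2)[OF T(1), of y'] T(2) by auto
    moreover have "(a3, b3) \<noteq> (a4, b4)"
    proof
      assume "(a3, b3) = (a4, b4)"
      then have eq: "a3 = a4" "b3 = b4" by simp_all
      have "[a1 + b1 = a2 + b2] (mod int m)"
        using rel unfolding eq cong_iff_dvd_diff dvd_def by algebra
      then show False using generic_pair[OF gen 1(2) 2(2)] \<open>(a1, b1) \<noteq> (a2, b2)\<close> by blast
    qed
    ultimately show False using generic_quadruple(1)[OF gen 1(2) 2(2) 3(2) 4(2)] rel by simp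
  qed
next
  note lin = linear_triplesD[OF translates_linear[OF gen]]
  fix x y z x' z' u u'
  assume T: "(x, y, z) \<in> translates m S" "(x', y, z') \<in> translates m S"
    "(x, u, z') \<in> translates m S" "(x', u', z) \<in> translates m S"
  obtain a1 b1 where 1: "step m (x, y, z) = (a1, b1)" "(a1, b1) \<in> S"
    "[a1 = int y - int x] (mod int m)" "[b1 = int z - int x] (mod int m)"
    by (rule translatesE[OF T(1)]) (rule that)
  obtain a2 b2 where 2: "step m (x', y, z') = (a2, b2)" "(a2, b2) \<in> S"
    "[a2 = int y - int x'] (mod int m)" "[b2 = int z' - int x'] (mod int m)"
    by (rule translatesE[OF T(2)]) (rule that)
  obtain a3 b3 where 3: "step m (x', u', z) = (a3, b3)" "(a3, b3) \<in> S"
    "[a3 = int u' - int x'] (mod int m)" "[b3 = int z - int x'] (mod int m)"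
    by (rule translatesE[OF T(4)]) (rule that)
  obtain a4 b4 where 4: "step m (x, u, z') = (a4, b4)" "(a4, b4) \<in> S"
    "[a4 = int u - int x] (mod int m)" "[b4 = int z' - int x] (mod int m)"
    by (rule translatesE[OF T(3)]) (rule that)
  have rel: "[b3 = b1 - a1 + a2] (mod int m)" "[b4 = b2 - a2 + a1] (mod int m)"
    using 1(3,4) 2(3,4) 3(3,4) 4(3,4) unfolding cong_iff_dvd_diff dvd_def by algebra+
  show "x = x'"
  proof (rule ccontr)
    assume ne: "x \<noteq> x'"
    have "(a1, b1) \<noteq> (a2, b2)" using step_eq_imp_eq[OF T(1,2)] 1(1) 2(1) ne by auto
    moreover have "(a1, b1) \<noteq> (a3, b3)" using step_eq_imp_eq[OF T(1,4)] 1(1) 3(1) ne by auto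
    moreover have "(a1, b1) \<noteq> (a4, b4)"
      using step_eq_imp_eq[OF T(1,3)] 1(1) 4(1) ne lin(3)[OF T(1), of x'] T(2) by auto
    moreover have "(a2, b2) \<noteq> (a3, b3)"
      using step_eq_imp_eq[OF T(2,4)] 2(1) 3(1) ne lin(3)[OF T(1), of x'] T(2) by auto
    moreover have "(a2, b2) \<noteq> (a4, b4)" using step_eq_imp_eq[OF T(2,3)] 2(1) 4(1) ne by auto
    moreover have "(a3, b3) \<noteq> (a4, b4)"
    proof
      assume "(a3, b3) = (a4, b4)"
      then have eq: "a3 = a4" "b3 = b4" by simp_all
      have "[b1 - 2 * a1 = b2 - 2 * a2] (mod int m)"
        using rel unfolding eq cong_iff_dvd_diff dvd_def by algebra
      then show False using generic_pair[OF gen 1(2) 2(2)] \<open>(a1, b1) \<noteq> (a2, b2)\<close> by blast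
    qed
    ultimately show False using generic_quadruple(2)[OF gen 1(2) 2(2) 3(2) 4(2)] rel by simp
  qed
next
  note lin = linear_triplesD[OF translates_linear[OF gen]]
  fix x y z x' y' u u'
  assume T: "(x, y, z) \<in> translates m S" "(x', y', z) \<in> translates m S"
    "(x, y', u) \<in> translates m S" "(x', y, u') \<in> translates m S"
  obtain a1 b1 where 1: "step m (x, y, z) = (a1, b1)" "(a1, b1) \<in> S"
    "[a1 = int y - int x] (mod int m)" "[b1 = int z - int x] (mod int m)"
    by (rule translatesE[OF T(1)]) (rule that)
  obtain a2 b2 where 2: "step m (x', y', z) = (a2, b2)" "(a2, b2) \<in> S"
    "[a2 = int y' - int x'] (mod int m)" "[b2 = int z - int x'] (mod int m)"
    by (rule translatesE[OF T(2)]) (rule that)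
  obtain a3 b3 where 3: "step m (x, y', u) = (a3, b3)" "(a3, b3) \<in> S"
    "[a3 = int y' - int x] (mod int m)" "[b3 = int u - int x] (mod int m)"
    by (rule translatesE[OF T(3)]) (rule that)
  obtain a4 b4 where 4: "step m (x', y, u') = (a4, b4)" "(a4, b4) \<in> S"
    "[a4 = int y - int x'] (mod int m)" "[b4 = int u' - int x'] (mod int m)"
    by (rule translatesE[OF T(4)]) (rule that)
  have rel: "[a3 = b1 - b2 + a2] (mod int m)" "[a4 = b2 - b1 + a1] (mod int m)"
    using 1(3,4) 2(3,4) 3(3,4) 4(3,4) unfolding cong_iff_dvd_diff dvd_def by algebra+
  show "x = x'"
  proof (rule ccontr)
    assume ne: "x \<noteq> x'"
    have "(a1, b1) \<noteq> (a2, b2)" using step_eq_imp_eq[OF T(1,2)] 1(1) 2(1) ne by auto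
    moreover have "(a1, b1) \<noteq> (a3, b3)"
      using step_eq_imp_eq[OF T(1,3)] 1(1) 3(1) ne lin(3)[OF T(1), of x'] T(2) by auto
    moreover have "(a1, b1) \<noteq> (a4, b4)" using step_eq_imp_eq[OF T(1,4)] 1(1) 4(1) ne by auto
    moreover have "(a2, b2) \<noteq> (a3, b3)" using step_eq_imp_eq[OF T(2,3)] 2(1) 3(1) ne by auto
    moreover have "(a2, b2) \<noteq> (a4, b4)"
      using step_eq_imp_eq[OF T(2,4)] 2(1) 4(1) ne lin(3)[OF T(1), of x'] T(2) by auto
    moreover have "(a3, b3) \<noteq> (a4, b4)"
    proof
      assume "(a3, b3) = (a4, b4)"
      then have eq: "a3 = a4" "b3 = b4" by simp_all
      have "[2 * b1 - a1 = 2 * b2 - a2] (mod int m)"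
        using rel unfolding eq cong_iff_dvd_diff dvd_def by algebra
      then show False using generic_pair[OF gen 1(2) 2(2)] \<open>(a1, b1) \<noteq> (a2, b2)\<close> by blast
    qed
    ultimately show False using generic_quadruple(3)[OF gen 1(2) 2(2) 3(2) 4(2)] rel by simp
  qed
qed

text \<open>
  If two rows of a grid were translates of each other, by \<open>\<delta>\<close> say, then the row and the three
  columns would satisfy the last congruences of a bad quadruple, \<open>\<delta>\<close> being eliminated.
  If two columns had the same generator as well, that generator and the one of the row would form a
  bad pair.
\<close>

lemma grid_rows_distinct_steps:
  assumes gen: "generic m S"
    and A: "(x0, y0, z0) \<in> translates m S" "(x1, y1, z1) \<in> translates m S"
    and C: "(x0, y1, z2) \<in> translates m S" "(x1, y2, z0) \<in> translates m S"
      "(x2, y0, z1) \<in> translates m S"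
    and ne: "x0 \<noteq> x1" "x0 \<noteq> x2" "x1 \<noteq> x2"
  shows "step m (x0, y0, z0) \<noteq> step m (x1, y1, z1)"
proof
  note lin = linear_triplesD[OF translates_linear[OF gen]]
  assume eq: "step m (x0, y0, z0) = step m (x1, y1, z1)"
  obtain a b where 0: "step m (x0, y0, z0) = (a, b)" "(a, b) \<in> S"
    "[a = int y0 - int x0] (mod int m)" "[b = int z0 - int x0] (mod int m)"
    by (rule translatesE[OF A(1)]) (rule that)
  obtain a' b' where E: "step m (x1, y1, z1) = (a', b')"
    "[a' = int y1 - int x1] (mod int m)" "[b' = int z1 - int x1] (mod int m)"
    by (rule translatesE[OF A(2)]) (rule that)
  have ab: "[a = int y1 - int x1] (mod int m)" "[b = int z1 - int x1] (mod int m)"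
    using 0(1) E eq by simp_all
  obtain a1 b1 where 1: "step m (x0, y1, z2) = (a1, b1)" "(a1, b1) \<in> S"
    "[a1 = int y1 - int x0] (mod int m)" "[b1 = int z2 - int x0] (mod int m)"
    by (rule translatesE[OF C(1)]) (rule that)
  obtain a2 b2 where 2: "step m (x1, y2, z0) = (a2, b2)" "(a2, b2) \<in> S"
    "[a2 = int y2 - int x1] (mod int m)" "[b2 = int z0 - int x1] (mod int m)"
    by (rule translatesE[OF C(2)]) (rule that)
  obtain a3 b3 where 3: "step m (x2, y0, z1) = (a3, b3)" "(a3, b3) \<in> S"
    "[a3 = int y0 - int x2] (mod int m)" "[b3 = int z1 - int x2] (mod int m)"
    by (rule translatesE[OF C(3)]) (rule that)
  have rel: "[b3 - a3 = b - a + (a1 - a)] (mod int m)" "[b2 = b - (a1 - a)] (mod int m)"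
    using 0(3,4) ab 1(3,4) 2(3,4) 3(3,4) unfolding cong_iff_dvd_diff dvd_def by algebra+
  have n1: "(a, b) \<noteq> (a1, b1)"
    using step_eq_imp_eq[OF A(1) C(1)] 0(1) 1(1) lin(3)[OF A(2), of x2] C(3) ne by auto
  have n2: "(a, b) \<noteq> (a2, b2)" using step_eq_imp_eq[OF A(1) C(2)] 0(1) 2(1) ne by auto
  have n3: "(a, b) \<noteq> (a3, b3)" using step_eq_imp_eq[OF A(1) C(3)] 0(1) 3(1) ne by auto
  have "(a1, b1) \<noteq> (a3, b3)"
  proof
    assume "(a1, b1) = (a3, b3)"
    then have eq: "a1 = a3" "b1 = b3" by simp_all
    have "[b - 2 * a = b1 - 2 * a1] (mod int m)"
      using rel unfolding eq cong_iff_dvd_diff dvd_def by algebra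
    then show False using generic_pair[OF gen 0(2) 1(2)] n1 by blast
  qed
  moreover have "(a1, b1) \<noteq> (a2, b2)"
  proof
    assume "(a1, b1) = (a2, b2)"
    then have eq: "a1 = a2" "b1 = b2" by simp_all
    have "[a + b = a1 + b1] (mod int m)"
      using rel unfolding eq cong_iff_dvd_diff dvd_def by algebra
    then show False using generic_pair[OF gen 0(2) 1(2)] n1 by blast
  qed
  moreover have "(a3, b3) \<noteq> (a2, b2)"
  proof
    assume "(a3, b3) = (a2, b2)"
    then have eq: "a3 = a2" "b3 = b2" by simp_all
    have "[2 * b - a = 2 * b2 - a2] (mod int m)"
      using rel unfolding eq cong_iff_dvd_diff dvd_def by algebra
    then show False using generic_pair[OF gen 0(2) 2(2)] n2 by blast
  qed
  ultimately show False
    using generic_quadruple(4)[OF gen 0(2) 1(2) 3(2) 2(2)] rel n1 n2 n3 by simp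
qed

text \<open>
  Rows and columns meet and therefore have distinct generators.  For two rows this is
  \<open>grid_rows_distinct_steps\<close>, up to a cyclic shift of the indices; exchanging rows and columns
  and reflecting the indices maps a grid to a grid of the same shape, so the columns are also
  covered.
\<close>

lemma translates_grid_free:
  assumes gen: "generic m S"
  shows "grid_free (translates m S)"
  unfolding grid_free_def
proof (intro allI impI; elim conjE; rule ccontr)
  note lin = linear_triplesD[OF translates_linear[OF gen]]
  fix x0 y0 z0 x1 y1 z1 x2 y2 z2
  assume A: "(x0, y0, z0) \<in> translates m S" "(x1, y1, z1) \<in> translates m S"
      "(x2, y2, z2) \<in> translates m S"
    and C: "(x0, y1, z2) \<in> translates m S" "(x1, y2, z0) \<in> translates m S"
      "(x2, y0, z1) \<in> translates m S"
    and "\<not> (x0 = x1 \<or> x0 = x2 \<or> x1 = x2)"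
  then have ne: "x0 \<noteq> x1" "x0 \<noteq> x2" "x1 \<noteq> x2" "x1 \<noteq> x0" "x2 \<noteq> x0" "x2 \<noteq> x1" by auto
  obtain a1 b1 where 1: "step m (x0, y0, z0) = (a1, b1)" "(a1, b1) \<in> S"
    "[a1 = int y0 - int x0] (mod int m)" "[b1 = int z0 - int x0] (mod int m)"
    by (rule translatesE[OF A(1)]) (rule that)
  obtain a2 b2 where 2: "step m (x1, y1, z1) = (a2, b2)" "(a2, b2) \<in> S"
    "[a2 = int y1 - int x1] (mod int m)" "[b2 = int z1 - int x1] (mod int m)"
    by (rule translatesE[OF A(2)]) (rule that)
  obtain a3 b3 where 3: "step m (x2, y2, z2) = (a3, b3)" "(a3, b3) \<in> S"
    "[a3 = int y2 - int x2] (mod int m)" "[b3 = int z2 - int x2] (mod int m)"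
    by (rule translatesE[OF A(3)]) (rule that)
  obtain c1 d1 where 4: "step m (x0, y1, z2) = (c1, d1)" "(c1, d1) \<in> S"
    "[c1 = int y1 - int x0] (mod int m)" "[d1 = int z2 - int x0] (mod int m)"
    by (rule translatesE[OF C(1)]) (rule that)
  obtain c2 d2 where 5: "step m (x1, y2, z0) = (c2, d2)" "(c2, d2) \<in> S"
    "[c2 = int y2 - int x1] (mod int m)" "[d2 = int z0 - int x1] (mod int m)"
    by (rule translatesE[OF C(2)]) (rule that)
  obtain c3 d3 where 6: "step m (x2, y0, z1) = (c3, d3)" "(c3, d3) \<in> S"
    "[c3 = int y0 - int x2] (mod int m)" "[d3 = int z1 - int x2] (mod int m)"
    by (rule translatesE[OF C(3)]) (rule that)
  have rel: "[d2 = b1 - (c1 - a2)] (mod int m)" "[b3 = d1 - (c1 - a2 + c2 - a3)] (mod int m)"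
    "[c3 = a1 - (c1 - a2 + c2 - a3)] (mod int m)" "[d3 = b2 - (c2 - a3)] (mod int m)"
    using 1(3,4) 2(3,4) 3(3,4) 4(3,4) 5(3,4) 6(3,4) unfolding cong_iff_dvd_diff dvd_def
    by algebra+
  note rows = grid_rows_distinct_steps[OF gen]
  have "(a1, b1) \<noteq> (a2, b2)" "(a2, b2) \<noteq> (a3, b3)" "(a3, b3) \<noteq> (a1, b1)"
    using rows[OF A(1,2) C ne(1-3)] rows[OF A(2,3) C(2,3,1) ne(3,4,5)]
      rows[OF A(3,1) C(3,1,2) ne(5,6,1)] 1(1) 2(1) 3(1) by simp_all
  moreover have "(c1, d1) \<noteq> (c3, d3)" "(c3, d3) \<noteq> (c2, d2)" "(c2, d2) \<noteq> (c1, d1)"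
    using rows[OF C(1,3) A(1,3,2) ne(2,1,6)] rows[OF C(3,2) A(3,2,1) ne(6,5,4)]
      rows[OF C(2,1) A(2,1,3) ne(4,3,2)] 4(1) 5(1) 6(1) by simp_all
  moreover have "(a1, b1) \<noteq> (c1, d1)"
    using step_eq_imp_eq[OF A(1) C(1)] 1(1) 4(1) lin(3)[OF A(2), of x2] C(3) ne by auto
  moreover have "(a2, b2) \<noteq> (c2, d2)"
    using step_eq_imp_eq[OF A(2) C(2)] 2(1) 5(1) lin(3)[OF A(3), of x0] C(1) ne by auto
  moreover have "(a3, b3) \<noteq> (c3, d3)"
    using step_eq_imp_eq[OF A(3) C(3)] 3(1) 6(1) lin(3)[OF A(1), of x1] C(2) ne by auto
  moreover have "(a1, b1) \<noteq> (c2, d2)" "(a1, b1) \<noteq> (c3, d3)" "(a2, b2) \<noteq> (c1, d1)"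
    "(a2, b2) \<noteq> (c3, d3)" "(a3, b3) \<noteq> (c1, d1)" "(a3, b3) \<noteq> (c2, d2)"
    using step_eq_imp_eq[OF A(1) C(2)] step_eq_imp_eq[OF A(1) C(3)] step_eq_imp_eq[OF A(2) C(1)]
      step_eq_imp_eq[OF A(2) C(3)] step_eq_imp_eq[OF A(3) C(1)] step_eq_imp_eq[OF A(3) C(2)]
      1(1) 2(1) 3(1) 4(1) 5(1) 6(1) ne by auto
  ultimately have "distinct [(a1, b1), (a2, b2), (a3, b3), (c1, d1), (c2, d2), (c3, d3)]"
    by simp metis
  moreover have "set [(a1, b1), (a2, b2), (a3, b3), (c1, d1), (c2, d2), (c3, d3)] \<subseteq> S"
    using 1(2) 2(2) 3(2) 4(2) 5(2) 6(2) by simp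
  ultimately show False using generic_sextuple[OF gen] rel by blast
qed

section \<open>Counting the forbidden tuples\<close>

lemma eq_mod_of_cong: "[u = e] (mod int m) \<Longrightarrow> u \<in> {0..<int m} \<Longrightarrow> u = e mod int m"
  by (auto simp: cong_def)

lemma card_image_Un_le:
  assumes "finite R" "X \<subseteq> (\<Union>f\<in>set fs. f ` R)"
  shows "finite X" "card X \<le> length fs * card R"
proof -
  show "finite X" by (rule finite_subset[OF assms(2)]) (use assms(1) in auto)
  have "card X \<le> card (\<Union>f\<in>set fs. f ` R)"
    using assms by (intro card_mono) auto
  also have "\<dots> \<le> (\<Sum>f\<in>set fs. card (f ` R))" by (rule card_UN_le) simp
  also have "\<dots> \<le> (\<Sum>f\<in>set fs. card R)" by (intro sum_mono card_image_le assms)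
  also have "\<dots> \<le> length fs * card R" by (simp add: card_length)
  finally show "card X \<le> length fs * card R" .
qed

text \<open>
  Each congruence determines one of the four residues from the other three; the functions below
  list the solutions.  The analogous counts for quadruples and sextuples lose one residue for each
  congruence.
\<close>

lemma card_bad_pairs: "finite (bad_pairs m)" "card (bad_pairs m) \<le> 6 * m ^ 3"
proof -
  define I where "I = {0..<int m}"
  define f1 where "f1 = (\<lambda>(a :: int, b :: int, t). [(a, b), (a mod int m, t)])"
  define f2 where "f2 = (\<lambda>(a :: int, b :: int, t). [(a, b), (t, b mod int m)])"
  define f3 where "f3 = (\<lambda>(a, b, t). [(a, b), (t, (b - a + t) mod int m)])"
  define f4 where "f4 = (\<lambda>(a, b, t). [(a, b), (t, (a + b - t) mod int m)])"
  define f5 where "f5 = (\<lambda>(a, b, t). [(a, b), (t, (b - 2 * a + 2 * t) mod int m)])"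
  define f6 where "f6 = (\<lambda>(a, b, t). [(a, b), ((2 * t - 2 * b + a) mod int m, t)])"
  have sub: "bad_pairs m \<subseteq> (\<Union>f\<in>set [f1, f2, f3, f4, f5, f6]. f ` (I \<times> I \<times> I))"
  proof
    fix l assume "l \<in> bad_pairs m"
    then obtain a b a' b' where l: "l = [(a, b), (a', b')]"
      and I: "a \<in> I" "b \<in> I" "a' \<in> I" "b' \<in> I"
      and c: "[a = a'] (mod int m) \<or> [b = b'] (mod int m) \<or> [b - a = b' - a'] (mod int m) \<or>
      [a + b = a' + b'] (mod int m) \<or> [b - 2 * a = b' - 2 * a'] (mod int m) \<or>
      [2 * b - a = 2 * b' - a'] (mod int m)"
      unfolding bad_pairs_def steps_def I_def by auto
    note eq = eq_mod_of_cong[where m = m, folded I_def]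
    from c consider "[a' = a] (mod int m)" | "[b' = b] (mod int m)" | "[b' = b - a + a'] (mod int m)"
      | "[b' = a + b - a'] (mod int m)" | "[b' = b - 2 * a + 2 * a'] (mod int m)"
      | "[a' = 2 * b' - 2 * b + a] (mod int m)"
      unfolding cong_iff_dvd_diff by (auto simp: dvd_diff_commute algebra_simps)
    then have "l = f1 (a, b, b') \<or> l = f2 (a, b, a') \<or> l = f3 (a, b, a') \<or> l = f4 (a, b, a') \<or>
      l = f5 (a, b, a') \<or> l = f6 (a, b, b')"
      unfolding l f1_def f2_def f3_def f4_def f5_def f6_def
      using eq[OF _ I(3)] eq[OF _ I(4)] by cases simp_all
    with I show "l \<in> (\<Union>f\<in>set [f1, f2, f3, f4, f5, f6]. f ` (I \<times> I \<times> I))" by auto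
  qed
  have R: "finite (I \<times> I \<times> I)" "card (I \<times> I \<times> I) = m ^ 3"
    by (simp_all add: I_def power3_eq_cube)
  show "finite (bad_pairs m)" "card (bad_pairs m) \<le> 6 * m ^ 3"
    using card_image_Un_le[OF R(1) sub] by (simp_all add: R)
qed

lemma card_bad_quadruples: "finite (bad_quadruples m)" "card (bad_quadruples m) \<le> 4 * m ^ 6"
proof -
  define I where "I = {0..<int m}"
  define f1 where "f1 = (\<lambda>(a1, b1, a2, b2, s, t).
    [(a1, b1), (a2, b2), (s, (b2 - a1 + s) mod int m), (t, (b1 - a2 + t) mod int m)])"
  define f2 where "f2 = (\<lambda>(a1, b1, a2, b2, s :: int, t :: int).
    [(a1, b1), (a2, b2), (s, (b1 - a1 + a2) mod int m), (t, (b2 - a2 + a1) mod int m)])"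
  define f3 where "f3 = (\<lambda>(a1, b1, a2, b2, s :: int, t :: int).
    [(a1, b1), (a2, b2), ((b1 - b2 + a2) mod int m, s), ((b2 - b1 + a1) mod int m, t)])"
  define f4 where "f4 = (\<lambda>(a1, b1, a2, b2 :: int, s, t :: int).
    [(a1, b1), (a2, b2), (s, (b1 - a1 + (a2 - a1) + s) mod int m), (t, (b1 - (a2 - a1)) mod int m)])"
  let ?R = "I \<times> I \<times> I \<times> I \<times> I \<times> I"
  have sub: "bad_quadruples m \<subseteq> (\<Union>f\<in>set [f1, f2, f3, f4]. f ` ?R)"
  proof
    fix l assume "l \<in> bad_quadruples m"
    then obtain a1 b1 a2 b2 a3 b3 a4 b4 where l: "l = [(a1, b1), (a2, b2), (a3, b3), (a4, b4)]"
      and I: "a1 \<in> I" "b1 \<in> I" "a2 \<in> I" "b2 \<in> I" "a3 \<in> I" "b3 \<in> I" "a4 \<in> I" "b4 \<in> I"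
      and c: "[b3 - a3 = b2 - a1] (mod int m) \<and> [b4 - a4 = b1 - a2] (mod int m) \<or>
      [b3 = b1 - a1 + a2] (mod int m) \<and> [b4 = b2 - a2 + a1] (mod int m) \<or>
      [a3 = b1 - b2 + a2] (mod int m) \<and> [a4 = b2 - b1 + a1] (mod int m) \<or>
      [b3 - a3 = b1 - a1 + (a2 - a1)] (mod int m) \<and> [b4 = b1 - (a2 - a1)] (mod int m)"
      unfolding bad_quadruples_def steps_def I_def by auto
    note eq = eq_mod_of_cong[where m = m, folded I_def]
    have move: "[u - v = w] (mod int m) \<Longrightarrow> [u = w + v] (mod int m)" for u v w
      unfolding cong_iff_dvd_diff by (simp add: algebra_simps)
    from c have "l = f1 (a1, b1, a2, b2, a3, a4) \<or> l = f2 (a1, b1, a2, b2, a3, a4) \<or>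
      l = f3 (a1, b1, a2, b2, b3, b4) \<or> l = f4 (a1, b1, a2, b2, a3, a4)"
      unfolding l f1_def f2_def f3_def f4_def prod.case list.inject prod.inject
      using eq[OF _ I(5)] eq[OF _ I(6)] eq[OF _ I(7)] eq[OF _ I(8)] move by meson
    with I show "l \<in> (\<Union>f\<in>set [f1, f2, f3, f4]. f ` ?R)" by auto
  qed
  have R: "finite ?R" "card ?R = m ^ 6"
    by (simp_all add: I_def numeral_eq_Suc)
  show "finite (bad_quadruples m)" "card (bad_quadruples m) \<le> 4 * m ^ 6"
    using card_image_Un_le[OF R(1) sub] by (simp_all add: R)
qed

lemma card_bad_sextuples: "finite (bad_sextuples m)" "card (bad_sextuples m) \<le> m ^ 8"
proof -
  define I where "I = {0..<int m}"
  define f where "f = (\<lambda>(a1, b1, a2, b2, a3, c1, d1, c2).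
    [(a1, b1), (a2, b2), (a3, (d1 - (c1 - a2 + c2 - a3)) mod int m),
     (c1, d1), (c2, (b1 - (c1 - a2)) mod int m),
     ((a1 - (c1 - a2 + c2 - a3)) mod int m, (b2 - (c2 - a3)) mod int m)])"
  let ?R = "I \<times> I \<times> I \<times> I \<times> I \<times> I \<times> I \<times> I"
  have sub: "bad_sextuples m \<subseteq> (\<Union>f\<in>set [f]. f ` ?R)"
  proof
    fix l assume "l \<in> bad_sextuples m"
    then obtain a1 b1 a2 b2 a3 b3 c1 d1 c2 d2 c3 d3
      where l: "l = [(a1, b1), (a2, b2), (a3, b3), (c1, d1), (c2, d2), (c3, d3)]"
      and I: "a1 \<in> I" "b1 \<in> I" "a2 \<in> I" "b2 \<in> I" "a3 \<in> I" "b3 \<in> I"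
        "c1 \<in> I" "d1 \<in> I" "c2 \<in> I" "d2 \<in> I" "c3 \<in> I" "d3 \<in> I"
      and c: "[d2 = b1 - (c1 - a2)] (mod int m)" "[b3 = d1 - (c1 - a2 + c2 - a3)] (mod int m)"
        "[c3 = a1 - (c1 - a2 + c2 - a3)] (mod int m)" "[d3 = b2 - (c2 - a3)] (mod int m)"
      unfolding bad_sextuples_def steps_def I_def by auto
    note eq = eq_mod_of_cong[where m = m, folded I_def]
    have "l = f (a1, b1, a2, b2, a3, c1, d1, c2)"
      unfolding l f_def prod.case list.inject prod.inject
      using eq[OF c(1) I(10)] eq[OF c(2) I(6)] eq[OF c(3) I(11)] eq[OF c(4) I(12)] by simp
    with I show "l \<in> (\<Union>f\<in>set [f]. f ` ?R)" by auto
  qed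
  have R: "finite ?R" "card ?R = m ^ 8"
    by (simp_all add: I_def numeral_eq_Suc)
  show "finite (bad_sextuples m)" "card (bad_sextuples m) \<le> m ^ 8"
    using card_image_Un_le[OF R(1) sub] by (simp_all add: R)
qed

lemma length_bad_tuple:
  "l \<in> bad_pairs m \<Longrightarrow> length l = 2" "l \<in> bad_quadruples m \<Longrightarrow> length l = 4" "l \<in> bad_sextuples m \<Longrightarrow> length l = 6"
  unfolding bad_pairs_def bad_quadruples_def bad_sextuples_def by auto

lemma sum_power_length_le:
  fixes p :: real
  assumes "\<And>l. l \<in> X \<Longrightarrow> length l = j" "card X \<le> c" "p \<ge> 0"
  shows "(\<Sum>l\<in>X. p ^ length l) \<le> real c * p ^ j"
proof -
  have "(\<Sum>l\<in>X. p ^ length l) = real (card X) * p ^ j" using assms(1) by simp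
  also have "\<dots> \<le> real c * p ^ j" using assms by (intro mult_right_mono) auto
  finally show ?thesis .
qed

text \<open>
  Bad tuples of length \<open>j\<close> are weighted by \<open>(K / m\<^sup>2) ^ j\<close> in the deletion method, because
  there are \<open>m\<^sup>2\<close> pairs of residues.
\<close>

lemma exists_generic:
  assumes "m > 0"
  shows "\<exists>S. generic m S \<and>
    real K - (6 * real K ^ 2 / m + 4 * real K ^ 4 / m ^ 2 + real K ^ 6 / m ^ 4) \<le> real (card S)"
proof -
  define p where "p = real K / real (card (steps m))"
  have card: "card (steps m) = m * m" by (simp add: steps_def)
  have p: "p = real K / real m ^ 2" "p \<ge> 0" by (simp_all add: p_def card power2_eq_square)
  note fin = card_bad_pairs(1) card_bad_quadruples(1) card_bad_sextuples(1)
  have disj: "bad_pairs m \<inter> bad_quadruples m = {}" "(bad_pairs m \<union> bad_quadruples m) \<inter> bad_sextuples m = {}"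
    using length_bad_tuple by fastforce+
  have "(\<Sum>l\<in>bad_pairs m \<union> bad_quadruples m \<union> bad_sextuples m. p ^ length l)
      = (\<Sum>l\<in>bad_pairs m. p ^ length l) + (\<Sum>l\<in>bad_quadruples m. p ^ length l) + (\<Sum>l\<in>bad_sextuples m. p ^ length l)"
    using fin disj by (simp add: sum.union_disjoint)
  also have "\<dots> \<le> real (6 * m ^ 3) * p ^ 2 + real (4 * m ^ 6) * p ^ 4 + real (m ^ 8) * p ^ 6"
    using length_bad_tuple card_bad_pairs card_bad_quadruples card_bad_sextuples p
    by (intro add_mono sum_power_length_le) auto
  also have "\<dots> = 6 * real K ^ 2 / m + 4 * real K ^ 4 / m ^ 2 + real K ^ 6 / m ^ 4"
    using assms by (simp add: p power_divide field_simps flip: power_mult power_add)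
      (simp add: eval_nat_numeral)
  finally have "\<exists>S\<subseteq>steps m.
    real K - (6 * real K ^ 2 / m + 4 * real K ^ 4 / m ^ 2 + real K ^ 6 / m ^ 4) \<le> real (card S) \<and>
    (\<forall>l\<in>bad_pairs m \<union> bad_quadruples m \<union> bad_sextuples m. set l \<subseteq> S \<longrightarrow> \<not> distinct l)"
    unfolding p_def
  proof (rule deletion_method[rotated -1])
    show "steps m \<noteq> {}" "finite (steps m)" using assms by (auto simp: steps_def)
    show "[] \<notin> bad_pairs m \<union> bad_quadruples m \<union> bad_sextuples m" using length_bad_tuple by fastforce
    show "[s, s] \<in> bad_pairs m \<union> bad_quadruples m \<union> bad_sextuples m" if "s \<in> steps m" for s
      using that unfolding bad_pairs_def by (cases s) auto
  qed (use fin in auto)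
  then show ?thesis unfolding generic_def by blast
qed

lemma generic_subset: "generic m S \<Longrightarrow> S' \<subseteq> S \<Longrightarrow> generic m S'"
  unfolding generic_def by (meson order_trans)

definition place :: "nat \<Rightarrow> int \<Rightarrow> int \<times> int \<Rightarrow> nat \<times> nat \<times> nat" where
  "place m e = (\<lambda>(a, b). (nat (e mod int m), nat ((e + a) mod int m), nat ((e + b) mod int m)))"

lemma place_in_box: "m > 0 \<Longrightarrow> place m e s \<in> box m"
  by (cases s) (simp add: place_def box_def nat_less_iff)

lemma step_place:
  assumes "m > 0" "s \<in> steps m"
  shows "step m (place m e s) = s"
proof -
  obtain a b where s: "s = (a, b)" by (cases s)
  have "((e + t) mod int m - e mod int m) mod int m = t" if "t \<in> {0..<int m}" for t
    using that by (simp add: mod_diff_eq)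
  then show ?thesis using assms by (simp add: s step_def place_def steps_def)
qed

text \<open>
  This gives regularity: each pair in \<open>S\<close> generates a perfect matching, so exactly one of the
  edges that it generates contains a given vertex.
\<close>

lemma translates_through_vertex:
  assumes "S \<subseteq> steps m" "v < 3 * m"
  shows "bij_betw (step m) {P \<in> translates m S. v \<in> edge m P} S"
proof -
  have m: "m > 0" using assms(2) by simp
  have "\<exists>e. v \<in> edge m (place m e s)" for s
  proof -
    obtain a b where s: "s = (a, b)" by (cases s)
    consider "v < m" | "m \<le> v" "v < 2 * m" | "2 * m \<le> v" by linarith
    then show ?thesis
    proof cases
      case 1
      then have "v \<in> edge m (place m (int v) s)" by (simp add: s place_def edge_def)
      then show ?thesis ..
    next
      case 2
      then have w: "v = m + (v - m)" "v - m < m" by simp_all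
      define w where "w = v - m"
      have "v \<in> edge m (place m (int w - a) s)"
        using w by (simp add: s place_def edge_def flip: w_def)
      then show ?thesis ..
    next
      case 3
      then have w: "v = 2 * m + (v - 2 * m)" "v - 2 * m < m" using assms(2) by simp_all
      define w where "w = v - 2 * m"
      have "v \<in> edge m (place m (int w - b) s)"
        using w by (simp add: s place_def edge_def flip: w_def)
      then show ?thesis ..
    qed
  qed
  then obtain e where e: "\<And>s. v \<in> edge m (place m (e s) s)" by metis
  have "inj_on (step m) {P \<in> translates m S. v \<in> edge m P}"
  proof (rule inj_onI)
    fix P P' assume P: "P \<in> {P \<in> translates m S. v \<in> edge m P}"
      "P' \<in> {P \<in> translates m S. v \<in> edge m P}" "step m P = step m P'"
    obtain x y z x' y' z' where eqs: "P = (x, y, z)" "P' = (x', y', z')" by (metis prod_cases3)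
    from P have T: "(x, y, z) \<in> translates m S" "(x', y', z') \<in> translates m S"
      and v: "v \<in> edge m (x, y, z)" "v \<in> edge m (x', y', z')"
      and eq: "step m (x, y, z) = step m (x', y', z')"
      by (simp_all add: eqs)
    have "x < m" "y < m" "z < m" "x' < m" "y' < m" "z' < m"
      using T by (auto simp: translates_def box_def)
    with v have "x = x' \<or> y = y' \<or> z = z'" by (auto simp: edge_def)
    with step_eq_imp_eq[OF T eq] show "P = P'" by (simp add: eqs)
  qed
  moreover have "s \<in> step m ` {P \<in> translates m S. v \<in> edge m P}" if "s \<in> S" for s
  proof -
    have eq: "step m (place m (e s) s) = s" using step_place m assms(1) that by blast
    then have "place m (e s) s \<in> {P \<in> translates m S. v \<in> edge m P}"
      using that e[of s] place_in_box[OF m, of "e s" s] unfolding translates_def by simp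
    from imageI[OF this, of "step m"] show ?thesis unfolding eq .
  qed
  moreover have "step m ` {P \<in> translates m S. v \<in> edge m P} \<subseteq> S"
    unfolding translates_def by auto
  ultimately show ?thesis unfolding bij_betw_def by blast
qed

lemma generic_imp_design:
  assumes gen: "generic m S"
  shows "optimal_superimposed_design3 {..<3 * m} (card S) (edge m ` translates m S)"
proof -
  let ?T = "translates m S"
  have S: "S \<subseteq> steps m" "finite S"
    using gen by (auto simp: generic_def steps_def intro: finite_subset)
  have box: "?T \<subseteq> box m" by (auto simp: translates_def)
  note lin = translates_linear[OF gen]
  have uni: "uniform 3 (edge m ` ?T)"
    unfolding uniform_def using card_edge box by blast
  have regular: "regular_on {..<3 * m} (card S) (edge m ` ?T)"
    unfolding regular_on_def
  proof
    fix v assume "v \<in> {..<3 * m}"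
    then have bij: "bij_betw (step m) {P \<in> ?T. v \<in> edge m P} S"
      using translates_through_vertex[OF S(1)] by simp
    have eq: "{A \<in> edge m ` ?T. v \<in> A} = edge m ` {P \<in> ?T. v \<in> edge m P}" by auto
    have "inj_on (edge m) {P \<in> ?T. v \<in> edge m P}"
      by (rule inj_on_subset[OF edge_inj]) (use box in auto)
    then have "card {A \<in> edge m ` ?T. v \<in> A} = card S"
      unfolding eq using bij by (simp add: card_image bij_betw_same_card)
    moreover have "finite {A \<in> edge m ` ?T. v \<in> A}"
      unfolding eq using bij S(2) by (simp add: bij_betw_finite)
    ultimately show "finite {A \<in> edge m ` ?T. v \<in> A} \<and> card {A \<in> edge m ` ?T. v \<in> A} = card S"
      by simp
  qed
  have "edge m ` ?T \<subseteq> Pow {..<3 * m}" using box by (auto simp: box_def edge_def)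
  moreover note uni regular linear_edges[OF lin box]
    linear_imp_cover_free[OF linear_edges[OF lin box] uni]
    union_free_edges[OF lin translates_twin_triangle_free[OF gen] translates_grid_free[OF gen] box]
  ultimately show ?thesis unfolding optimal_superimposed_design3_def by simp
qed

text \<open>
  With \<open>r\<close> for the cube root of \<open>m\<close> and a sample of about \<open>r\<^sup>2 / 5\<close> pairs, the expected loss is at
  most \<open>6 r / 25 + 4 r\<^sup>2 / 625 + 1\<close>, which leaves more than \<open>21 r\<^sup>2 / 250 + 1\<close> pairs as soon as
  \<open>r \<ge> 7\<close>.  The bound on \<open>k\<close> has the factor \<open>21 / 250\<close> because \<open>3 powr (2 / 3) / 25\<close> is
  below it, and the summand 1 because the lower bound on the maximal degree requires rounding up.
\<close>

lemma design_of_small_degree: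
  assumes m: "real m = r ^ 3" "r \<ge> 7" and k: "real k \<le> 21 / 250 * r ^ 2 + 1"
  shows "\<exists>F. optimal_superimposed_design3 {..<3 * m} k F"
proof -
  define K where "K = nat \<lfloor>r ^ 2 / 5\<rfloor>"
  have K: "real K \<le> r ^ 2 / 5" "r ^ 2 / 5 - 1 \<le> real K"
    unfolding K_def by (auto simp: of_nat_nat) linarith
  have "m > 0" using m by (intro Nat.gr0I) auto
  then obtain S where S: "generic m S"
    "real K - (6 * real K ^ 2 / m + 4 * real K ^ 4 / m ^ 2 + real K ^ 6 / m ^ 4) \<le> real (card S)"
    using exists_generic by blast
  have "6 * real K ^ 2 / m \<le> 6 * (r ^ 2 / 5) ^ 2 / r ^ 3"
    unfolding m(1) using K m(2) by (intro divide_right_mono mult_left_mono power_mono) auto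
  also have "\<dots> = 6 / 25 * r" using m(2) by (simp add: field_simps eval_nat_numeral)
  finally have 1: "6 * real K ^ 2 / m \<le> 6 / 25 * r" .
  have "4 * real K ^ 4 / m ^ 2 \<le> 4 * (r ^ 2 / 5) ^ 4 / (r ^ 3) ^ 2"
    unfolding of_nat_power m(1) using K m(2)
    by (intro divide_right_mono mult_left_mono power_mono) auto
  also have "\<dots> = 4 / 625 * r ^ 2" using m(2) by (simp add: field_simps eval_nat_numeral)
  finally have 2: "4 * real K ^ 4 / m ^ 2 \<le> 4 / 625 * r ^ 2" .
  have "real K ^ 6 / m ^ 4 \<le> (r ^ 2 / 5) ^ 6 / (r ^ 3) ^ 4"
    unfolding of_nat_power m(1) using K m(2) by (intro divide_right_mono power_mono) auto
  also have "\<dots> \<le> 1" using m(2) by (simp add: field_simps eval_nat_numeral)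
  finally have 3: "real K ^ 6 / m ^ 4 \<le> 1" .
  have "7 * r \<le> r ^ 2" using m(2) by (simp add: power2_eq_square)
  with 1 2 3 K S(2) k m(2) have "real k \<le> real (card S)" by linarith
  then obtain S' where S': "S' \<subseteq> S" "card S' = k"
    by (meson obtain_subset_with_card_n of_nat_le_iff)
  from generic_imp_design[OF generic_subset[OF S(1) S'(1)]] S'(2) show ?thesis by auto
qed

theorem proposition1p16:
  shows "\<exists>n0 :: nat. \<forall>n :: nat. n \<ge> n0 \<and> 3 dvd n \<longrightarrow>
    (\<forall>k :: nat. 1 \<le> k \<and> real k \<le> (1 / 25) * real n powr (2 / 3) \<longrightarrow>
       (\<exists>F :: nat set set. optimal_superimposed_design3 {..<n} k F)) \<and>
    (1 / 25) * real n powr (2 / 3) \<le> real (kprime3 n)"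
proof (intro exI[of _ 1029] allI impI)
  \<comment> \<open>\<open>1029 = 3 * 7 ^ 3\<close>, so that the cube root of \<open>n / 3\<close> is at least 7.\<close>
  fix n :: nat assume n: "n \<ge> 1029 \<and> 3 dvd n"
  then obtain m where m: "n = 3 * m" by auto
  define r where "r = real m powr (1 / 3)"
  have r3: "real m = r ^ 3"
    using n m by (simp add: r_def powr_powr flip: powr_realpow)
  have "r \<ge> 7"
  proof (rule ccontr)
    assume "\<not> r \<ge> 7"
    then have "r ^ 3 < 7 ^ 3" by (intro power_strict_mono) (auto simp: r_def)
    with r3 n m show False by simp
  qed
  have "(3 :: real) powr (2 / 3) \<le> 21 / 10"
  proof -
    have "((3 :: real) powr (2 / 3)) ^ 3 = (3 powr (2 / 3)) powr 3" by simp
    also have "\<dots> = 3 powr 2" by (simp only: powr_powr) simp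
    also have "\<dots> \<le> (21 / 10) ^ 3" by (simp add: power_divide)
    finally show ?thesis by (rule power_mono_iff[THEN iffD1, rotated 3]) simp_all
  qed
  moreover have "real m powr (2 / 3) = r ^ 2"
    using n m by (simp add: r_def powr_powr flip: powr_realpow)
  ultimately have "3 powr (2 / 3) * real m powr (2 / 3) \<le> 21 / 10 * r ^ 2"
    by (intro mult_mono) auto
  then have le: "1 / 25 * real n powr (2 / 3) \<le> 21 / 250 * r ^ 2"
    unfolding m by (simp add: powr_mult mult_ac)
  have design: "\<exists>F. optimal_superimposed_design3 {..<n} k F" if "real k \<le> 21 / 250 * r ^ 2 + 1" for k
    using design_of_small_degree[OF r3 \<open>r \<ge> 7\<close> that] m by simp
  show "(\<forall>k :: nat. 1 \<le> k \<and> real k \<le> (1 / 25) * real n powr (2 / 3) \<longrightarrow>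
       (\<exists>F :: nat set set. optimal_superimposed_design3 {..<n} k F)) \<and>
    (1 / 25) * real n powr (2 / 3) \<le> real (kprime3 n)"
  proof (intro conjI allI impI)
    fix k :: nat assume "1 \<le> k \<and> real k \<le> (1 / 25) * real n powr (2 / 3)"
    with le show "\<exists>F. optimal_superimposed_design3 {..<n} k F" by (intro design) linarith
  next
    define k where "k = nat \<lceil>(1 / 25) * real n powr (2 / 3)\<rceil>"
    have "1 / 25 * real n powr (2 / 3) \<ge> 0" by simp
    then have k: "(1 / 25) * real n powr (2 / 3) \<le> real k" "real k \<le> (1 / 25) * real n powr (2 / 3) + 1"
      unfolding k_def by linarith+
    with le have "exists_design3 n k" unfolding exists_design3_def by (intro design) linarith
    moreover have "n > 0" using n by simp
    ultimately have "k \<le> kprime3 n" by (intro kprime3_is_max)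
    with k show "(1 / 25) * real n powr (2 / 3) \<le> real (kprime3 n)" by linarith
  qed
qed

end
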